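(* Let $G$ be an Abelian group of finite rank. Then $G$ is nil-clean if and only if $G$ is a finite $2$-group.
   Context: An element of an (associative, unital) ring $R$ is called nil-clean if it is the sum of an idempotent and a nilpotent element of $R$. The ring $R$ is called nil-clean if all its elements are nil-clean. An Abelian group is called nil-clean if its endomorphism ring $\mathrm{End}(G)$ is nil-clean. The rank of an Abelian group $G$ is the cardinality of a maximal independent subset of $G$ consisting only of elements of infinite order or of prime-power order (so it takes torsion into account; it is not just the torsion-free rank). *)

theory Defs
  imports "HOL-Number_Theory.Prime_Powers" "HOL-Algebra.Multiplicative_Group"
begin

definition idempotent_elem :: "('r, 's) ring_scheme \<Rightarrow> 'r \<Rightarrow> bool" where
  "idempotent_elem R e \<longleftrightarrow> e \<in> carrier R \<and> e \<otimes>\<^bsub>R\<^esub> e = e"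

definition nilpotent_elem :: "('r, 's) ring_scheme \<Rightarrow> 'r \<Rightarrow> bool" where
  "nilpotent_elem R t \<longleftrightarrow> t \<in> carrier R \<and> (\<exists>k::nat. t [^]\<^bsub>R\<^esub> k = \<zero>\<^bsub>R\<^esub>)"

definition nil_clean_elem :: "('r, 's) ring_scheme \<Rightarrow> 'r \<Rightarrow> bool" where
  "nil_clean_elem R a \<longleftrightarrow>
    (\<exists>e t. idempotent_elem R e \<and> nilpotent_elem R t \<and> a = e \<oplus>\<^bsub>R\<^esub> t)"

definition nil_clean_ring :: "('r, 's) ring_scheme \<Rightarrow> bool" where
  "nil_clean_ring R \<longleftrightarrow> ring R \<and> (\<forall>a\<in>carrier R. nil_clean_elem R a)"

text \<open>
  Abelian groups are commutative groups in the sense of HOL-Algebra, hence written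
  multiplicatively: the sum of two endomorphisms is their pointwise product in \<open>G\<close>.
  Endomorphisms are extensional functions, so that each one is represented by exactly one
  element of the carrier.
\<close>

definition End_ring :: "('a, 'b) monoid_scheme \<Rightarrow> ('a \<Rightarrow> 'a) ring" where
  "End_ring G =
    \<lparr>carrier = hom G G \<inter> extensional (carrier G),
     mult = compose (carrier G),
     one = (\<lambda>x\<in>carrier G. x),
     zero = (\<lambda>x\<in>carrier G. \<one>\<^bsub>G\<^esub>),
     add = (\<lambda>f g. \<lambda>x\<in>carrier G. f x \<otimes>\<^bsub>G\<^esub> g x)\<rparr>"

lemma ring_End_ring:
  fixes G (structure)
  assumes "comm_group G"
  shows "ring (End_ring G)"
proof -
  interpret comm_group G by (rule assms)
  define E where "E = hom G G \<inter> extensional (carrier G)"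
  note End_defs = End_ring_def E_def [symmetric]
  have clo: "f x \<in> carrier G" if "f \<in> E" "x \<in> carrier G" for f x
    using that by (auto simp: E_def hom_def)
  have mul: "f (x \<otimes> y) = f x \<otimes> f y" if "f \<in> E" "x \<in> carrier G" "y \<in> carrier G" for f x y
    using that by (auto simp: E_def hom_def)
  have ext: "f = g" if "f \<in> E" "g \<in> E" "\<And>x. x \<in> carrier G \<Longrightarrow> f x = g x" for f g
    using that by (auto simp: E_def intro: extensionalityI)
  have E_I: "restrict f (carrier G) \<in> E"
    if "\<And>x. x \<in> carrier G \<Longrightarrow> f x \<in> carrier G"
       "\<And>x y. x \<in> carrier G \<Longrightarrow> y \<in> carrier G \<Longrightarrow> f (x \<otimes> y) = f x \<otimes> f y" for f
    using that by (auto simp: E_def hom_def)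
  have add: "(\<lambda>x\<in>carrier G. f x \<otimes> g x) \<in> E" if "f \<in> E" "g \<in> E" for f g
    by (rule E_I) (use that in \<open>auto simp: clo mul m_ac\<close>)
  have zero: "(\<lambda>x\<in>carrier G. \<one>) \<in> E"
    by (rule E_I) auto
  have one: "(\<lambda>x\<in>carrier G. x) \<in> E"
    by (rule E_I) auto
  have comp: "compose (carrier G) f g \<in> E" if "f \<in> E" "g \<in> E" for f g
    unfolding compose_def
    by (rule E_I) (use that in \<open>auto simp: clo mul\<close>)
  have neg: "(\<lambda>x\<in>carrier G. inv (f x)) \<in> E" if "f \<in> E" for f
    by (rule E_I) (use that in \<open>auto simp: clo mul inv_mult\<close>)
  show ?thesis
  proof (rule ringI)
    show "abelian_group (End_ring G)"
    proof (rule abelian_groupI)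
      fix f assume "f \<in> carrier (End_ring G)"
      hence f: "f \<in> E" by (simp add: End_defs)
      have "(\<lambda>x\<in>carrier G. inv (f x)) \<oplus>\<^bsub>End_ring G\<^esub> f = \<zero>\<^bsub>End_ring G\<^esub>"
        using f by (auto simp: End_defs fun_eq_iff restrict_def clo)
      thus "\<exists>g\<in>carrier (End_ring G). g \<oplus>\<^bsub>End_ring G\<^esub> f = \<zero>\<^bsub>End_ring G\<^esub>"
        using neg[OF f] by (intro bexI) (auto simp: End_defs)
      show "\<zero>\<^bsub>End_ring G\<^esub> \<oplus>\<^bsub>End_ring G\<^esub> f = f"
        using f add[OF zero f] by (intro ext) (auto simp: End_defs clo)
    next
      fix f g h
      assume "f \<in> carrier (End_ring G)" "g \<in> carrier (End_ring G)" "h \<in> carrier (End_ring G)"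
      hence "f \<in> E" "g \<in> E" "h \<in> E" by (simp_all add: End_defs)
      thus "f \<oplus>\<^bsub>End_ring G\<^esub> g \<oplus>\<^bsub>End_ring G\<^esub> h = f \<oplus>\<^bsub>End_ring G\<^esub> (g \<oplus>\<^bsub>End_ring G\<^esub> h)"
        by (auto simp: End_defs fun_eq_iff restrict_def clo m_ac)
    next
      fix f g
      assume "f \<in> carrier (End_ring G)" "g \<in> carrier (End_ring G)"
      hence fg: "f \<in> E" "g \<in> E" by (simp_all add: End_defs)
      show "f \<oplus>\<^bsub>End_ring G\<^esub> g \<in> carrier (End_ring G)"
        using add[OF fg] by (simp add: End_defs)
      show "f \<oplus>\<^bsub>End_ring G\<^esub> g = g \<oplus>\<^bsub>End_ring G\<^esub> f"
        using fg by (auto simp: End_defs fun_eq_iff restrict_def clo m_comm)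
    qed (use zero in \<open>simp add: End_defs\<close>)
    show "monoid (End_ring G)"
    proof (rule monoidI)
      fix f g assume "f \<in> carrier (End_ring G)" "g \<in> carrier (End_ring G)"
      thus "f \<otimes>\<^bsub>End_ring G\<^esub> g \<in> carrier (End_ring G)"
        using comp[of f g] by (simp add: End_defs)
    next
      fix f g h
      assume "f \<in> carrier (End_ring G)" "g \<in> carrier (End_ring G)" "h \<in> carrier (End_ring G)"
      hence "f \<in> E" "g \<in> E" "h \<in> E" by (simp_all add: End_defs)
      thus "f \<otimes>\<^bsub>End_ring G\<^esub> g \<otimes>\<^bsub>End_ring G\<^esub> h = f \<otimes>\<^bsub>End_ring G\<^esub> (g \<otimes>\<^bsub>End_ring G\<^esub> h)"
        by (auto simp: End_defs fun_eq_iff restrict_def compose_def clo)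
    next
      fix f assume "f \<in> carrier (End_ring G)"
      hence f: "f \<in> E" by (simp add: End_defs)
      show "\<one>\<^bsub>End_ring G\<^esub> \<otimes>\<^bsub>End_ring G\<^esub> f = f"
        using f comp[OF one f] by (intro ext) (auto simp: End_defs compose_eq clo)
      show "f \<otimes>\<^bsub>End_ring G\<^esub> \<one>\<^bsub>End_ring G\<^esub> = f"
        using f comp[OF f one] by (intro ext) (auto simp: End_defs compose_eq clo)
    qed (use one in \<open>simp add: End_defs\<close>)
  next
    fix f g h
    assume "f \<in> carrier (End_ring G)" "g \<in> carrier (End_ring G)" "h \<in> carrier (End_ring G)"
    hence fgh: "f \<in> E" "g \<in> E" "h \<in> E" by (simp_all add: End_defs)
    show "(f \<oplus>\<^bsub>End_ring G\<^esub> g) \<otimes>\<^bsub>End_ring G\<^esub> h =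
        f \<otimes>\<^bsub>End_ring G\<^esub> h \<oplus>\<^bsub>End_ring G\<^esub> g \<otimes>\<^bsub>End_ring G\<^esub> h"
      using fgh by (auto simp: End_defs fun_eq_iff restrict_def compose_def clo)
    show "h \<otimes>\<^bsub>End_ring G\<^esub> (f \<oplus>\<^bsub>End_ring G\<^esub> g) =
        h \<otimes>\<^bsub>End_ring G\<^esub> f \<oplus>\<^bsub>End_ring G\<^esub> h \<otimes>\<^bsub>End_ring G\<^esub> g"
      using fgh by (auto simp: End_defs fun_eq_iff restrict_def compose_def clo mul)
  qed
qed

definition nil_clean_group :: "('a, 'b) monoid_scheme \<Rightarrow> bool" where
  "nil_clean_group G \<longleftrightarrow> nil_clean_ring (End_ring G)"

text \<open>
  Independence in the sense of abelian group theory: a relation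
  \<open>n\<^sub>1 x\<^sub>1 + \<dots> + n\<^sub>k x\<^sub>k = 0\<close> forces every \<open>n\<^sub>i x\<^sub>i\<close>, not necessarily \<open>n\<^sub>i\<close>, to vanish.
\<close>

definition independent_set :: "('a, 'b) monoid_scheme \<Rightarrow> 'a set \<Rightarrow> bool" where
  "independent_set G X \<longleftrightarrow>
    X \<subseteq> carrier G \<and> \<one>\<^bsub>G\<^esub> \<notin> X \<and>
    (\<forall>F n. finite F \<and> F \<subseteq> X \<and> (\<Otimes>\<^bsub>G\<^esub>x\<in>F. x [^]\<^bsub>G\<^esub> (n x :: int)) = \<one>\<^bsub>G\<^esub>
      \<longrightarrow> (\<forall>x\<in>F. x [^]\<^bsub>G\<^esub> n x = \<one>\<^bsub>G\<^esub>))"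

text \<open>Note that \<^const>\<open>group.ord\<close> is \<open>0\<close> on elements of infinite order.\<close>

definition rank_system :: "('a, 'b) monoid_scheme \<Rightarrow> 'a set \<Rightarrow> bool" where
  "rank_system G X \<longleftrightarrow>
    independent_set G X \<and> (\<forall>x\<in>X. group.ord G x = 0 \<or> primepow (group.ord G x))"

definition maximal_rank_system :: "('a, 'b) monoid_scheme \<Rightarrow> 'a set \<Rightarrow> bool" where
  "maximal_rank_system G X \<longleftrightarrow>
    rank_system G X \<and> (\<forall>Y. rank_system G Y \<and> X \<subseteq> Y \<longrightarrow> Y = X)"

text \<open>
  The rank of \<open>G\<close> is the common cardinality of all maximal systems, of which there is at
  least one by Zorn's lemma; so it is finite iff some maximal system is finite.
\<close>

definition finite_rank :: "('a, 'b) monoid_scheme \<Rightarrow> bool" where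
  "finite_rank G \<longleftrightarrow> (\<exists>X. maximal_rank_system G X \<and> finite X)"

definition p_group :: "nat \<Rightarrow> ('a, 'b) monoid_scheme \<Rightarrow> bool" where
  "p_group p G \<longleftrightarrow> group G \<and> (\<forall>x\<in>carrier G. \<exists>k::nat. group.ord G x = p ^ k)"

end

theory Submission
  imports Defs
begin

text \<open>
  If every endomorphism is nil-clean, then so is \<open>2 = e + t\<close>. Multiplying by the idempotent
  \<open>e\<close> gives \<open>t e = e = e t\<close>, so \<open>2 = t (1 + e)\<close> with commuting factors, and \<open>2\<close> inherits
  nilpotency from \<open>t\<close>: the group has exponent \<open>2\<^sup>k\<close>. An element of order \<open>2\<close> outside a subgroup
  containing a maximal system would enlarge the system, so finite rank makes the socle finite
  (the subgroup of elements \<open>x\<close> with \<open>2 x = 0\<close>), and a group of bounded exponent with finite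
  socle is finite.

  The converse is by induction on the order of a finite \<open>2\<close>-group \<open>G\<close>, and rests on two facts.

  \<^item> Linear algebra over the field of two elements, along the lines of the proof that matrix
  rings over this field are nil-clean. Let \<open>2\<^sup>k\<^sup>+\<^sup>1\<close> be the exponent of \<open>G\<close>. An endomorphism \<open>a\<close>
  acts on the elementary abelian group \<open>U = 2\<^sup>k G\<close>. On the cyclic subspace \<open>W\<close> spanned by the
  orbit of some \<open>v \<noteq> 0\<close>, there is a decomposition \<open>W = M \<oplus> S\<close> such that \<open>a\<close> minus the projection onto
  \<open>S\<close> along \<open>M\<close> is nilpotent (lemma \<open>nil_clean_splitting_exists\<close>). One cyclic
  block at a time suffices, because a block triangular matrix with nilpotent diagonal blocks is nilpotent.

  \<^item> Lifting from the socle to \<open>G\<close>. As \<open>M\<close> and \<open>S\<close> consist of elements of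
  height \<open>k\<close>, they are the socles of homogeneous subgroups \<open>A\<close> and \<open>B\<close>, that is, of direct
  sums of cyclic groups of order \<open>2\<^sup>k\<^sup>+\<^sup>1\<close> (\<open>homogeneous_lift\<close>), and \<open>A \<oplus> B\<close> is a
  direct summand of \<open>G\<close> (\<open>homogeneous_complement\<close>).

  Write \<open>G = A \<oplus> B \<oplus> K\<close>. By induction the compression of \<open>a\<close> to \<open>K\<close> is an idempotent \<open>e'\<close> plus a
  nilpotent \<open>t'\<close>. Let \<open>e\<close> be \<open>0\<close> on \<open>A\<close>, the identity on \<open>B\<close> and \<open>e'\<close> on \<open>K\<close>. On the
  socle of \<open>G\<close>, the difference \<open>t = a - e\<close> is nilpotent on \<open>W\<close> and agrees
  with \<open>t'\<close> modulo \<open>W\<close> on the socle of \<open>K\<close>. So \<open>t\<close> is nilpotent on the socle, and hence on \<open>G\<close>.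
\<close>

section \<open>Local nilpotency of endomorphisms\<close>

definition locally_nilpotent_part :: "('a, 'b) monoid_scheme \<Rightarrow> ('a \<Rightarrow> 'a) \<Rightarrow> 'a set" where
  "locally_nilpotent_part G t = {x \<in> carrier G. \<exists>n. (t ^^ n) x = \<one>\<^bsub>G\<^esub>}"

context comm_group
begin

lemma hom_funpow:
  assumes "t \<in> hom G G"
  shows "(t ^^ n) \<in> hom G G"
  by (induction n) (use assms in \<open>auto simp: hom_def Pi_iff\<close>)

lemma hom_funpow_one: "t \<in> hom G G \<Longrightarrow> (t ^^ n) \<one> = \<one>"
  using hom_one[OF hom_funpow is_group is_group] by simp

lemma hom_funpow_closed: "t \<in> hom G G \<Longrightarrow> x \<in> carrier G \<Longrightarrow> (t ^^ n) x \<in> carrier G"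
  using hom_in_carrier[OF hom_funpow] by simp

lemma hom_funpow_mult:
  "t \<in> hom G G \<Longrightarrow> x \<in> carrier G \<Longrightarrow> y \<in> carrier G \<Longrightarrow> (t ^^ n) (x \<otimes> y) = (t ^^ n) x \<otimes> (t ^^ n) y"
  using hom_mult[OF hom_funpow] by simp

lemma hom_inv_apply: "t \<in> hom G G \<Longrightarrow> x \<in> carrier G \<Longrightarrow> t (inv x) = inv (t x)"
  using group_hom.hom_inv[of G G t] by (auto simp: group_hom_def group_hom_axioms_def)

lemma hom_nat_pow_apply:
  "t \<in> hom G G \<Longrightarrow> x \<in> carrier G \<Longrightarrow> t (x [^] (n::nat)) = t x [^] n"
  using group_hom.hom_nat_pow[of G G t] by (auto simp: group_hom_def group_hom_axioms_def)

lemma locally_nilpotent_subgroup: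
  assumes t: "t \<in> hom G G"
  shows "subgroup (locally_nilpotent_part G t) G"
proof (rule subgroupI)
  show "locally_nilpotent_part G t \<noteq> {}"
    using hom_funpow_one[OF t] by (auto simp: locally_nilpotent_part_def)
next
  fix x assume "x \<in> locally_nilpotent_part G t"
  then obtain n where "x \<in> carrier G" "(t ^^ n) x = \<one>"
    by (auto simp: locally_nilpotent_part_def)
  then have "inv x \<in> carrier G" "(t ^^ n) (inv x) = \<one>"
    using hom_inv_apply[OF hom_funpow[OF t]] by simp_all
  then show "inv x \<in> locally_nilpotent_part G t"
    unfolding locally_nilpotent_part_def by blast
next
  fix x y assume x: "x \<in> locally_nilpotent_part G t" and y: "y \<in> locally_nilpotent_part G t"
  then obtain m n where mn: "(t ^^ m) x = \<one>" "(t ^^ n) y = \<one>"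
    by (auto simp: locally_nilpotent_part_def)
  have "(t ^^ (n + m)) x = \<one>" "(t ^^ (m + n)) y = \<one>"
    using mn hom_funpow_one[OF t] by (auto simp: funpow_add)
  then show "x \<otimes> y \<in> locally_nilpotent_part G t"
    using x y hom_funpow_mult[OF t]
    by (auto simp: locally_nilpotent_part_def add.commute intro!: exI[of _ "m + n"])
qed (auto simp: locally_nilpotent_part_def)

lemma locally_nilpotent_back:
  assumes "(t ^^ n) x \<in> locally_nilpotent_part G t" "x \<in> carrier G"
  shows "x \<in> locally_nilpotent_part G t"
proof -
  obtain m where "(t ^^ m) ((t ^^ n) x) = \<one>"
    using assms(1) by (auto simp: locally_nilpotent_part_def)
  then have "(t ^^ (m + n)) x = \<one>" by (simp add: funpow_add)
  then show ?thesis using assms(2) unfolding locally_nilpotent_part_def by blast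
qed

lemma locally_nilpotent_back1:
  assumes "t x \<in> locally_nilpotent_part G t" "x \<in> carrier G"
  shows "x \<in> locally_nilpotent_part G t"
  using locally_nilpotent_back[where n = 1] assms by simp

text \<open>
  If \<open>t\<^sup>n\<close> kills the multiple \<open>2\<^sup>k x\<close>, which lies in the socle when \<open>x\<close> has order
  \<open>2\<^sup>k\<^sup>+\<^sup>1\<close>, then \<open>t\<^sup>n x\<close> has smaller order than \<open>x\<close>, and induction on the order applies.
\<close>

lemma locally_nilpotent_from_socle:
  assumes t: "t \<in> hom G G"
    and exp: "\<And>x. x \<in> carrier G \<Longrightarrow> x [^] ((2::nat) ^ K) = \<one>"
    and soc: "\<And>x. x \<in> carrier G \<Longrightarrow> x \<otimes> x = \<one> \<Longrightarrow> x \<in> locally_nilpotent_part G t"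
  shows "locally_nilpotent_part G t = carrier G"
proof -
  have "x \<in> locally_nilpotent_part G t" if "x \<in> carrier G" "x [^] ((2::nat) ^ k) = \<one>" for x k
    using that
  proof (induction k arbitrary: x)
    case 0
    then show ?case
      using subgroup.one_closed[OF locally_nilpotent_subgroup[OF t]] by simp
  next
    case (Suc k)
    define y where "y = x [^] ((2::nat) ^ k)"
    have y: "y \<in> carrier G" using Suc.prems by (simp add: y_def)
    have "y \<otimes> y = \<one>" using Suc.prems by (simp add: y_def nat_pow_mult mult_2)
    from soc[OF y this] obtain n where n: "(t ^^ n) y = \<one>"
      by (auto simp: locally_nilpotent_part_def)
    have "(t ^^ n) x [^] ((2::nat) ^ k) = \<one>"
      using n hom_nat_pow_apply[OF hom_funpow[OF t]] Suc.prems(1) by (simp add: y_def)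
    then have "(t ^^ n) x \<in> locally_nilpotent_part G t"
      using Suc hom_funpow_closed[OF t] by blast
    then show ?case by (rule locally_nilpotent_back) (rule Suc.prems)
  qed
  from this[OF _ exp] show ?thesis by (auto simp: locally_nilpotent_part_def)
qed

end

section \<open>Cyclic blocks over the field of two elements\<close>

text \<open>
  The span of \<open>v, a v, \<dots>, a\<^sup>n\<^sup>-\<^sup>1 v\<close> in an elementary abelian \<open>2\<close>-group, built by adjoining one
  vector at a time: the recursion shows directly which coefficient of the last vector occurs.
\<close>

primrec orbit_span :: "('a, 'b) monoid_scheme \<Rightarrow> ('a \<Rightarrow> 'a) \<Rightarrow> 'a \<Rightarrow> nat \<Rightarrow> 'a set" where
  "orbit_span G a v 0 = {\<one>\<^bsub>G\<^esub>}"
| "orbit_span G a v (Suc n) =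
    orbit_span G a v n \<union> (\<lambda>m. (a ^^ n) v \<otimes>\<^bsub>G\<^esub> m) ` orbit_span G a v n"

text \<open>
  An \<open>a\<close>-invariant elementary abelian \<open>2\<close>-subgroup \<open>U\<close> with a vector \<open>v\<close>. The endomorphism \<open>a\<close>
  stays defined on all of \<open>G\<close>, since the results are applied to endomorphisms of \<open>G\<close>.
\<close>

locale elementary_endo = comm_group G for G (structure) +
  fixes U :: "'a set" and a :: "'a \<Rightarrow> 'a" and v :: 'a
  assumes U: "subgroup U G" and sq: "\<And>x. x \<in> U \<Longrightarrow> x \<otimes> x = \<one>"
    and a: "a \<in> hom G G" and aU: "\<And>x. x \<in> U \<Longrightarrow> a x \<in> U"
    and v: "v \<in> U"
begin

abbreviation w :: "nat \<Rightarrow> 'a" where "w n \<equiv> (a ^^ n) v"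
abbreviation Sp :: "nat \<Rightarrow> 'a set" where "Sp \<equiv> orbit_span G a v"

lemma U_carrier: "x \<in> U \<Longrightarrow> x \<in> carrier G"
  using subgroup.mem_carrier[OF U] .

lemma U_mult: "x \<in> U \<Longrightarrow> y \<in> U \<Longrightarrow> x \<otimes> y \<in> U"
  using subgroup.m_closed[OF U] .

text \<open>
  Together with the ordered rewrite rules for a commutative product, cancellation of equal
  factors decides equations between products of elements of \<open>U\<close>.
\<close>

lemma U_cancel: "x \<in> U \<Longrightarrow> y \<in> carrier G \<Longrightarrow> x \<otimes> (x \<otimes> y) = y"
  using sq U_carrier by (simp flip: m_assoc)

lemmas U_simps = U_carrier U_mult U_cancel sq m_ac

lemma a_mult: "x \<in> U \<Longrightarrow> y \<in> U \<Longrightarrow> a (x \<otimes> y) = a x \<otimes> a y"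
  using a U_carrier by (auto simp: hom_def)

lemma w_U: "w n \<in> U"
  by (induction n) (auto simp: v aU)

lemma Sp_U: "m \<in> Sp n \<Longrightarrow> m \<in> U"
proof (induction n arbitrary: m)
  case 0
  then show ?case using subgroup.one_closed[OF U] by simp
next
  case (Suc n)
  then show ?case using U_mult[OF w_U] by auto
qed

lemma elementary_subgroupI:
  assumes "M \<subseteq> U" "\<one> \<in> M" "\<And>x y. x \<in> M \<Longrightarrow> y \<in> M \<Longrightarrow> x \<otimes> y \<in> M"
  shows "subgroup M G"
proof (rule subgroupI)
  show "inv x \<in> M" if "x \<in> M" for x
    using inv_equality[of x x] sq[of x] U_carrier[of x] that assms(1) by auto
qed (use assms U_carrier in auto)

lemma Sp_one: "\<one> \<in> Sp n"
  by (induction n) auto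

lemma Sp_mult: "x \<in> Sp n \<Longrightarrow> y \<in> Sp n \<Longrightarrow> x \<otimes> y \<in> Sp n"
proof (induction n arbitrary: x y)
  case 0
  then show ?case by simp
next
  case (Suc n)
  have Sp_Suc_I: "w n \<otimes> m \<in> Sp (Suc n)" if "m \<in> Sp n" for m using that by auto
  have red: "\<exists>m \<in> Sp n. z = m \<or> z = w n \<otimes> m" if "z \<in> Sp (Suc n)" for z
    using that by auto
  obtain p q where "p \<in> Sp n" "q \<in> Sp n" "x = p \<or> x = w n \<otimes> p" "y = q \<or> y = w n \<otimes> q"
    using red Suc.prems by meson
  moreover from this have "p \<in> U" "q \<in> U" "p \<otimes> q \<in> Sp n"
    using Sp_U Suc.IH by auto
  ultimately show ?case
    using w_U[of n] Sp_Suc_I[of "p \<otimes> q"] Sp_U[of _ n]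
    by (elim disjE) (simp_all add: U_simps)
qed

lemma Sp_subgroup: "subgroup (Sp n) G"
  using Sp_U Sp_one Sp_mult by (intro elementary_subgroupI) auto

lemma Sp_mono: "m \<le> n \<Longrightarrow> Sp m \<subseteq> Sp n"
  by (rule lift_Suc_mono_le[of Sp]) auto

lemma w_Sp: "i < n \<Longrightarrow> w i \<in> Sp n"
proof -
  assume "i < n"
  have "w i = w i \<otimes> \<one>" using w_U U_carrier by simp
  then have "w i \<in> Sp (Suc i)" using Sp_one[of i] by auto
  with Sp_mono[of "Suc i" n] \<open>i < n\<close> show ?thesis by auto
qed

lemma Sp_subset_subgroup:
  assumes "subgroup L G" "\<And>i. i < n \<Longrightarrow> w i \<in> L"
  shows "Sp n \<subseteq> L"
  using assms(2)
proof (induction n)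
  case 0
  then show ?case using subgroup.one_closed[OF assms(1)] by simp
next
  case (Suc n)
  then show ?case using subgroup.m_closed[OF assms(1)] by auto
qed

text \<open>
  While \<open>t\<close> shifts along the orbit, nilpotency at \<open>w n\<close> passes back to \<open>w (n - 1), \<dots>, w 0\<close>.
\<close>

lemma orbit_locally_nilpotent:
  assumes "t \<in> hom G G" and "w n \<in> locally_nilpotent_part G t"
    and "\<And>i. i < n \<Longrightarrow> t (w i) = w (Suc i)"
  shows "Sp (Suc n) \<subseteq> locally_nilpotent_part G t"
proof -
  have *: "w (n - i) \<in> locally_nilpotent_part G t" if "i \<le> n" for i
    using that
  proof (induction i)
    case 0
    then show ?case using assms by simp
  next
    case (Suc i)
    have "t (w (n - Suc i)) = w (n - i)"
      using assms(3)[of "n - Suc i"] Suc.prems by (simp add: Suc_diff_Suc)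
    then show ?case
      using Suc locally_nilpotent_back1[OF _ U_carrier[OF w_U]] by simp
  qed
  have "w i \<in> locally_nilpotent_part G t" if "i < Suc n" for i
    using *[of "n - i"] that by simp
  then show ?thesis
    by (intro Sp_subset_subgroup locally_nilpotent_subgroup assms)
qed

text \<open>
  The direct sum \<open>M \<oplus> S\<close> is nonzero, and \<open>a\<close> minus the projection onto \<open>S\<close> along \<open>M\<close> is nilpotent
  on it. The condition is phrased for every endomorphism \<open>t\<close> of \<open>G\<close> that restricts to this
  difference, because \<open>M \<oplus> S\<close> is in general no direct summand of \<open>G\<close>, so the projection itself
  is not available as an endomorphism of \<open>G\<close>. On \<open>S\<close> the condition \<open>t s = a s - s\<close> is
  written without an inverse.
\<close>

definition nil_clean_splitting :: "'a set \<Rightarrow> 'a set \<Rightarrow> bool" where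
  "nil_clean_splitting M S \<longleftrightarrow> subgroup M G \<and> subgroup S G \<and> M \<subseteq> U \<and> S \<subseteq> U \<and> M \<inter> S = {\<one>} \<and> M \<union> S \<noteq> {\<one>} \<and>
    (\<forall>t \<in> hom G G. (\<forall>m\<in>M. t m = a m) \<longrightarrow> (\<forall>s\<in>S. t s \<otimes> s = a s) \<longrightarrow>
       M \<union> S \<subseteq> locally_nilpotent_part G t)"

text \<open>
  The case of a nilpotent cyclic block: the idempotent is zero.
\<close>

lemma nil_clean_splitting_nilpotent:
  assumes "v \<noteq> \<one>" "w n = \<one>"
  shows "nil_clean_splitting (Sp n) {\<one>}"
  unfolding nil_clean_splitting_def
proof (intro conjI ballI impI)
  have "n \<noteq> 0" using assms by (intro notI) simp
  then show "Sp n \<union> {\<one>} \<noteq> {\<one>}"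
    using w_Sp[of 0 n] assms(1) by auto
  fix t assume t: "t \<in> hom G G" and tm: "\<forall>m\<in>Sp n. t m = a m"
  have "w n \<in> locally_nilpotent_part G t"
    using assms(2) subgroup.one_closed[OF locally_nilpotent_subgroup[OF t]] by simp
  from orbit_locally_nilpotent[OF t this] tm w_Sp
  show "Sp n \<union> {\<one>} \<subseteq> locally_nilpotent_part G t"
    using subgroup.one_closed[OF locally_nilpotent_subgroup[OF t]] by auto
qed (use Sp_subgroup Sp_U Sp_one triv_subgroup subgroup.one_closed[OF U] in auto)

text \<open>
  The companion matrix of a polynomial of trace one is the nilpotent shift plus its last column,
  and that column forms an idempotent of rank one. In terms of vectors, the idempotent is the projection
  onto the image \<open>w (n + 1)\<close> of the last basis vector along the span of the other basis vectors;
  it has the same value \<open>w (n + 1)\<close> at \<open>w n\<close>, so \<open>t\<close> shifts along the orbit and kills \<open>w n\<close>.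
\<close>

lemma nil_clean_splitting_trace_one:
  assumes "w n \<notin> Sp n" "w (Suc n) = w n \<otimes> m" "m \<in> Sp n"
  shows "nil_clean_splitting (Sp n) {\<one>, w (Suc n)}"
  unfolding nil_clean_splitting_def
proof (intro conjI ballI impI)
  define q where "q = w (Suc n)"
  have mU: "m \<in> U" using assms Sp_U by blast
  have qU: "q \<in> U" by (simp only: q_def w_U)
  have wn: "w n = q \<otimes> m" unfolding q_def assms(2) using mU w_U by (simp add: U_simps)
  have q: "q \<notin> Sp n" using wn assms(1,3) Sp_mult[of q n m] by auto
  then show "Sp n \<inter> {\<one>, w (Suc n)} = {\<one>}" "Sp n \<union> {\<one>, w (Suc n)} \<noteq> {\<one>}"
    using Sp_one[of n] unfolding q_def[symmetric] by auto
  show "{\<one>, w (Suc n)} \<subseteq> U" "subgroup {\<one>, w (Suc n)} G"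
    using qU subgroup.one_closed[OF U] unfolding q_def[symmetric]
    by (auto intro!: elementary_subgroupI simp: sq U_carrier)
  fix t assume t: "t \<in> hom G G" and tm: "\<forall>m\<in>Sp n. t m = a m"
    and ts: "\<forall>s\<in>{\<one>, w (Suc n)}. t s \<otimes> s = a s"
  interpret L: subgroup "locally_nilpotent_part G t" G
    by (rule locally_nilpotent_subgroup[OF t])
  have tq: "t q = a q \<otimes> q"
  proof -
    have "t q \<otimes> q = a q" using ts by (simp add: q_def)
    moreover have "t q \<in> carrier G" using t qU U_carrier by (auto simp: hom_def)
    ultimately show ?thesis using qU U_carrier sq by (metis m_assoc r_one)
  qed
  have "t (w n) = t q \<otimes> t m"
    unfolding wn using t mU qU U_carrier by (auto simp: hom_def)
  also have "\<dots> = q \<otimes> a (q \<otimes> m)"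
    using tq tm assms(3) mU qU aU by (simp add: U_simps a_mult)
  also have "\<dots> = \<one>" unfolding wn[symmetric] using sq[OF qU] by (simp add: q_def)
  finally have "w n \<in> locally_nilpotent_part G t"
    using locally_nilpotent_back1[OF _ U_carrier[OF w_U]] by (simp del: funpow.simps)
  from orbit_locally_nilpotent[OF t this] tm w_Sp
  have *: "Sp (Suc n) \<subseteq> locally_nilpotent_part G t" by auto
  moreover have "q \<in> Sp (Suc n)" using assms(2,3) by (auto simp: q_def)
  ultimately show "Sp n \<union> {\<one>, w (Suc n)} \<subseteq> locally_nilpotent_part G t"
    using L.one_closed by (auto simp: q_def)
qed (use Sp_subgroup Sp_U in auto)

text \<open>
  When the trace is zero, an idempotent of rank two is required. The last two basis vectors
  \<open>w n\<close> and \<open>w (n + 1)\<close> are replaced by \<open>w n\<close> and \<open>f = w (n + 1) + p\<close>, where \<open>p\<close> differs from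
  \<open>w n\<close> by an element of the span of the earlier ones. The idempotent \<open>e\<close> projects onto the plane spanned by
  \<open>p\<close> and \<open>a f\<close> along that span. Then \<open>e (w n) = p\<close>, and if \<open>a f\<close> agrees with \<open>f\<close>
  modulo the span, also \<open>e f = a f\<close>. So \<open>t = a - e\<close> is the nilpotent shift
  \<open>w 0 \<mapsto> w 1 \<mapsto> \<dots> \<mapsto> w n \<mapsto> f \<mapsto> 0\<close>.
\<close>

lemma nil_clean_splitting_trace_zero:
  assumes ind: "w n \<notin> Sp n" "w (Suc n) \<notin> Sp (Suc n)"
    and d: "d \<in> Sp n" and p: "p = w n \<otimes> d" and f: "f = w (Suc n) \<otimes> p"
    and af: "a f = f \<otimes> d'" and d': "d' \<in> Sp n"
  shows "nil_clean_splitting (Sp n) {\<one>, p, a f, p \<otimes> a f}"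
  unfolding nil_clean_splitting_def
proof (intro conjI ballI impI)
  define q where "q = a f"
  have dU: "d \<in> U" "d' \<in> U" using d d' Sp_U by auto
  have pU: "p \<in> U" using p dU w_U U_mult by simp
  have fU: "f \<in> U" using f pU w_U U_mult by blast
  have qU: "q \<in> U" using fU aU by (simp add: q_def)
  have wn: "w n = p \<otimes> d" unfolding p using dU w_U by (simp add: U_simps)
  have wn': "w (Suc n) = f \<otimes> p" unfolding f using pU w_U[of "Suc n"] by (simp add: U_simps)
  have fq: "f = q \<otimes> d'" unfolding q_def af using dU fU by (simp add: U_simps)
  have p_nin: "p \<notin> Sp n" using wn ind d Sp_mult[of p n d] by auto
  have p_in: "p \<in> Sp (Suc n)" using p d by auto
  have d'_in: "d' \<in> Sp (Suc n)" using d' by auto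
  have f_nin: "f \<notin> Sp (Suc n)" using wn' ind p_in Sp_mult[of f "Suc n" p] by auto
  have q_nin: "q \<notin> Sp (Suc n)" using fq f_nin d'_in Sp_mult[of q "Suc n" d'] by auto
  have "p \<otimes> q \<otimes> p = q" using pU qU by (simp add: U_simps)
  then have pq_nin: "p \<otimes> q \<notin> Sp (Suc n)"
    using q_nin p_in Sp_mult[of "p \<otimes> q" "Suc n" p] by auto
  show "Sp n \<inter> {\<one>, p, a f, p \<otimes> a f} = {\<one>}" "Sp n \<union> {\<one>, p, a f, p \<otimes> a f} \<noteq> {\<one>}"
    using Sp_one[of n] p_nin q_nin pq_nin unfolding q_def[symmetric] by auto
  show "{\<one>, p, a f, p \<otimes> a f} \<subseteq> U" "subgroup {\<one>, p, a f, p \<otimes> a f} G"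
    using pU qU subgroup.one_closed[OF U] unfolding q_def[symmetric]
    by (auto intro!: elementary_subgroupI simp: U_simps)
  fix t assume t: "t \<in> hom G G" and tm: "\<forall>m\<in>Sp n. t m = a m"
    and ts: "\<forall>s\<in>{\<one>, p, a f, p \<otimes> a f}. t s \<otimes> s = a s"
  interpret L: subgroup "locally_nilpotent_part G t" G
    by (rule locally_nilpotent_subgroup[OF t])
  have t_closed: "t x \<in> carrier G" if "x \<in> U" for x using t that U_carrier by (auto simp: hom_def)
  have t_mult: "t (x \<otimes> y) = t x \<otimes> t y" if "x \<in> U" "y \<in> U" for x y
    using t that U_carrier by (auto simp: hom_def)
  have tp: "t p = a p \<otimes> p" and tq: "t q = a q \<otimes> q"
    using ts t_closed pU qU U_carrier sq by (auto simp: q_def) (metis m_assoc r_one)+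
  have "t f = t q \<otimes> t d'"
    using t_mult[OF qU dU(2)] unfolding fq[symmetric] .
  also have "\<dots> = a (q \<otimes> d') \<otimes> q"
    using tq tm d' dU qU aU by (simp add: U_simps a_mult)
  also have "\<dots> = \<one>" unfolding fq[symmetric] q_def[symmetric] using sq[OF qU] .
  finally have fL: "f \<in> locally_nilpotent_part G t"
    using locally_nilpotent_back1[OF _ U_carrier[OF fU]] by (simp del: funpow.simps)
  have "t (w n) = t p \<otimes> t d"
    using t_mult[OF pU dU(1)] unfolding wn[symmetric] .
  also have "\<dots> = a (p \<otimes> d) \<otimes> p"
    using tp tm d dU pU aU by (simp add: U_simps a_mult)
  also have "\<dots> = f" unfolding wn[symmetric] using f by simp
  finally have "w n \<in> locally_nilpotent_part G t"
    using fL locally_nilpotent_back1[OF _ U_carrier[OF w_U]] by (simp del: funpow.simps)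
  from orbit_locally_nilpotent[OF t this] tm w_Sp
  have *: "Sp (Suc n) \<subseteq> locally_nilpotent_part G t" by auto
  then have pL: "p \<in> locally_nilpotent_part G t" and d'L: "d' \<in> locally_nilpotent_part G t"
    using p_in d'_in by auto
  have "q = f \<otimes> d'" by (simp add: q_def af)
  then have "q \<in> locally_nilpotent_part G t" using fL d'L by simp
  then show "Sp n \<union> {\<one>, p, a f, p \<otimes> a f} \<subseteq> locally_nilpotent_part G t"
    using L.one_closed pL * by (auto simp: q_def[symmetric])
qed (use Sp_subgroup Sp_U in auto)

text \<open>
  Let \<open>n\<close> be the dimension of the cyclic block, so that \<open>w n\<close> is a combination of the earlier
  \<open>w i\<close>. If it is nonzero, its coefficient at \<open>w (n - 1)\<close> is the trace. When the trace is zero, the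
  coefficient at \<open>w (n - 2)\<close> decides between two choices of \<open>p\<close>: the vector \<open>w (n - 2)\<close> when
  it is one and the vector \<open>w (n - 2) + w (n - 3)\<close> when it is zero. In both cases
  \<open>a f - f\<close> lies in the span of \<open>w 0, \<dots>, w (n - 3)\<close>. If the dimension is too small for
  these vectors to exist, then \<open>w n\<close> is zero and the nilpotent case applies.
\<close>

lemma nil_clean_splitting_exists:
  assumes fin: "finite U" and v1: "v \<noteq> \<one>"
  shows "\<exists>M S. nil_clean_splitting M S"
proof -
  have ex: "\<exists>n. w n \<in> Sp n"
  proof (rule ccontr)
    assume *: "\<nexists>n. w n \<in> Sp n"
    have "w i \<noteq> w j" if "i < j" for i j
      using * w_Sp[OF that] by metis
    then have "inj w" by (metis injI nat_neq_iff)
    moreover have "range w \<subseteq> U" using w_U by auto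
    ultimately show False using fin finite_subset finite_imageD by blast
  qed
  define n where "n = (LEAST n. w n \<in> Sp n)"
  have n: "w n \<in> Sp n" unfolding n_def using ex by (rule LeastI_ex)
  have less: "w i \<notin> Sp i" if "i < n" for i using that not_less_Least unfolding n_def by blast
  show ?thesis
  proof (cases "w n = \<one>")
    case True
    then show ?thesis using nil_clean_splitting_nilpotent[OF v1] by blast
  next
    case w1: False
    have "n \<noteq> 0" using n v1 by (intro notI) simp
    then obtain k where k: "n = Suc k" by (cases n) auto
    \<comment> \<open>The coefficient of the last basis vector \<open>w k\<close> is one or zero.\<close>
    from n consider m where "m \<in> Sp k" "w n = w k \<otimes> m" | "w n \<in> Sp k"
      unfolding k by auto
    then show ?thesis
    proof cases
      case 1
      then show ?thesis using nil_clean_splitting_trace_one[of k m] less[of k] k by blast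
    next
      case 2
      have "k \<noteq> 0" using 2 w1 by (intro notI) simp
      then obtain l where l: "k = Suc l" by (cases k) auto
      note nl = k l
      have lin: "w l \<notin> Sp l" "w (Suc l) \<notin> Sp (Suc l)"
        using less[of l] less[of "Suc l"] by (simp_all add: nl del: funpow.simps orbit_span.simps)
      have wU: "w l \<in> U" "w (Suc l) \<in> U" "w (Suc (Suc l)) \<in> U" by (rule w_U)+
      \<comment> \<open>The coefficient of the last but one basis vector \<open>w l\<close> is one or zero.\<close>
      from 2 consider m where "m \<in> Sp l" "w n = w l \<otimes> m" | "w n \<in> Sp l"
        unfolding l by auto
      then show ?thesis
      proof cases
        case 1
        define p where "p = w l \<otimes> \<one>"
        define f where "f = w (Suc l) \<otimes> p"
        have mU: "m \<in> U" using 1 Sp_U by blast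
        have "a f = w (Suc (Suc l)) \<otimes> w (Suc l)"
          using wU U_carrier by (simp add: f_def p_def a_mult del: funpow.simps) simp
        also have "\<dots> = f \<otimes> m"
          using 1(2) wU U_carrier mU by (simp add: nl f_def p_def m_ac del: funpow.simps)
        finally show ?thesis
          using nil_clean_splitting_trace_zero[OF lin Sp_one p_def f_def _ 1(1)] by blast
      next
        case 2
        have "l \<noteq> 0" using 2 w1 by (intro notI) simp
        then obtain r where r: "l = Suc r" by (cases l) auto
        have wr: "w r \<in> U" "w r \<in> Sp l" using w_U w_Sp[of r l] r by auto
        define p where "p = w l \<otimes> w r"
        define f where "f = w (Suc l) \<otimes> p"
        have pU: "p \<in> U" using wU wr U_mult by (simp add: p_def)
        have ap: "a p = w (Suc l) \<otimes> w l"
          using wU wr by (simp add: p_def a_mult) (simp add: r)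
        have "a f = w (Suc (Suc l)) \<otimes> (w (Suc l) \<otimes> w l)"
          unfolding f_def a_mult[OF wU(2) pU] ap by simp
        also have "\<dots> = f \<otimes> (w (Suc (Suc l)) \<otimes> w r)"
          using wU wr by (simp add: f_def p_def U_simps del: funpow.simps)
        finally show ?thesis
          using nil_clean_splitting_trace_zero[OF lin wr(2) p_def f_def _ Sp_mult[of _ l, OF _ wr(2)]]
            2[unfolded nl] by blast
      qed
    qed
  qed
qed

end

section \<open>Homogeneous subgroups and their complements\<close>

text \<open>
  Inside a group of exponent \<open>2\<^sup>k\<^sup>+\<^sup>1\<close> this says that \<open>A\<close> is a direct sum of cyclic groups of
  order \<open>2\<^sup>k\<^sup>+\<^sup>1\<close>. The formulation through socle elements of height \<open>k\<close> avoids a choice of basis.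
\<close>

definition homogeneous_subgroup :: "('a, 'b) monoid_scheme \<Rightarrow> nat \<Rightarrow> 'a set \<Rightarrow> bool" where
  "homogeneous_subgroup G k A \<longleftrightarrow> subgroup A G \<and>
    (\<forall>x\<in>A. x \<otimes>\<^bsub>G\<^esub> x = \<one>\<^bsub>G\<^esub> \<longrightarrow> (\<exists>g\<in>A. g [^]\<^bsub>G\<^esub> ((2::nat) ^ k) = x))"

context comm_group
begin

lemma nat_pow_closed_subgroup: "subgroup H G \<Longrightarrow> x \<in> H \<Longrightarrow> x [^] (n::nat) \<in> H"
  by (induction n) (auto simp: subgroup.one_closed subgroup.m_closed)

lemma subset_set_mult:
  assumes "subgroup A G" "subgroup B G"
  shows "A \<subseteq> A <#> B" "B \<subseteq> A <#> B"
proof safe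
  fix x assume x: "x \<in> A"
  then have "x \<otimes> \<one> \<in> A <#> B" using subgroup.one_closed[OF assms(2)] unfolding set_mult_def by blast
  then show "x \<in> A <#> B" using subgroup.mem_carrier[OF assms(1) x] by simp
next
  fix x assume x: "x \<in> B"
  then have "\<one> \<otimes> x \<in> A <#> B" using subgroup.one_closed[OF assms(1)] unfolding set_mult_def by blast
  then show "x \<in> A <#> B" using subgroup.mem_carrier[OF assms(2) x] by simp
qed

lemma mult_inv_cancel: "x \<in> carrier G \<Longrightarrow> y \<in> carrier G \<Longrightarrow> x \<otimes> (inv x \<otimes> y) = y"
  by (simp flip: m_assoc)

lemma square_pow: "x \<in> carrier G \<Longrightarrow> (x \<otimes> x) [^] ((2::nat) ^ k) = x [^] ((2::nat) ^ Suc k)"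
  unfolding power_Suc mult_2 by (simp only: nat_pow_distrib nat_pow_mult)

text \<open>
  A nonzero subgroup of bounded exponent \<open>2\<^sup>K\<close> contains an element of order \<open>2\<close>.
\<close>

lemma trivial_int_from_socle:
  assumes A: "subgroup A G" and B: "subgroup B G"
    and exp: "\<And>x. x \<in> carrier G \<Longrightarrow> x [^] ((2::nat) ^ K) = \<one>"
    and soc: "\<And>x. x \<in> A \<Longrightarrow> x \<in> B \<Longrightarrow> x \<otimes> x = \<one> \<Longrightarrow> x = \<one>"
  shows "A \<inter> B = {\<one>}"
proof -
  interpret A: subgroup A G by fact
  interpret B: subgroup B G by fact
  have "x = \<one>" if "x \<in> A" "x \<in> B" "x [^] ((2::nat) ^ k) = \<one>" for x k
    using that
  proof (induction k arbitrary: x)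
    case 0
    then show ?case by simp
  next
    case (Suc k)
    have "x \<otimes> x = \<one>"
      by (rule Suc.IH) (use Suc.prems A.mem_carrier square_pow in \<open>simp_all del: power_Suc\<close>)
    then show ?case using soc Suc.prems by blast
  qed
  then have "x = \<one>" if "x \<in> A" "x \<in> B" for x
    using that exp[OF A.mem_carrier] by blast
  then show ?thesis using A.one_closed B.one_closed by blast
qed

lemma socle_of_direct_product:
  assumes A: "subgroup A G" and B: "subgroup B G" and int: "A \<inter> B = {\<one>}"
    and x: "x \<in> A <#> B" "x \<otimes> x = \<one>"
  obtains \<alpha> \<beta> where "\<alpha> \<in> A" "\<beta> \<in> B" "x = \<alpha> \<otimes> \<beta>" "\<alpha> \<otimes> \<alpha> = \<one>" "\<beta> \<otimes> \<beta> = \<one>"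
proof -
  interpret A: subgroup A G by fact
  interpret B: subgroup B G by fact
  obtain \<alpha> \<beta> where ab: "\<alpha> \<in> A" "\<beta> \<in> B" "x = \<alpha> \<otimes> \<beta>"
    using x(1) unfolding set_mult_def by blast
  have e: "(\<alpha> \<otimes> \<alpha>) \<otimes> (\<beta> \<otimes> \<beta>) = \<one>" using x(2) ab by (simp add: m_ac)
  then have "\<alpha> \<otimes> \<alpha> = inv (\<beta> \<otimes> \<beta>)" using ab inv_equality[OF e] by simp
  moreover have "\<alpha> \<otimes> \<alpha> \<in> A" "inv (\<beta> \<otimes> \<beta>) \<in> B" using ab by simp_all
  ultimately have "\<alpha> \<otimes> \<alpha> \<in> A \<inter> B" by simp
  then have "\<alpha> \<otimes> \<alpha> = \<one>" using int by simp
  then show ?thesis using that[OF ab] e ab by simp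
qed

lemma homogeneous_direct_product:
  assumes A: "homogeneous_subgroup G k A" and B: "homogeneous_subgroup G k B"
    and int: "A \<inter> B = {\<one>}"
  shows "homogeneous_subgroup G k (A <#> B)"
proof -
  have sub: "subgroup A G" "subgroup B G" using A B by (auto simp: homogeneous_subgroup_def)
  show ?thesis
    unfolding homogeneous_subgroup_def
  proof (intro conjI ballI impI)
    show "subgroup (A <#> B) G" using sub by (rule mult_subgroups)
    fix x assume "x \<in> A <#> B" "x \<otimes> x = \<one>"
    then obtain \<alpha> \<beta> where ab: "\<alpha> \<in> A" "\<beta> \<in> B" "x = \<alpha> \<otimes> \<beta>" "\<alpha> \<otimes> \<alpha> = \<one>" "\<beta> \<otimes> \<beta> = \<one>"
      by (rule socle_of_direct_product[OF sub int])
    then obtain g h where gh: "g \<in> A" "g [^] ((2::nat) ^ k) = \<alpha>" "h \<in> B" "h [^] ((2::nat) ^ k) = \<beta>"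
      using A B unfolding homogeneous_subgroup_def by metis
    then have "(g \<otimes> h) [^] ((2::nat) ^ k) = x"
      using ab sub by (simp add: nat_pow_distrib subgroup.mem_carrier)
    then show "\<exists>g\<in>A <#> B. g [^] ((2::nat) ^ k) = x"
      using gh unfolding set_mult_def by blast
  qed
qed

text \<open>
  Under these conditions \<open>g\<close> has order \<open>2\<^sup>k\<^sup>+\<^sup>1\<close> and \<open>x\<close> is the only element of order \<open>2\<close> in the
  cyclic group that it generates.
\<close>

lemma homogeneous_cyclic:
  assumes g: "g \<in> carrier G" and top: "g [^] ((2::nat) ^ k) = x" "x \<noteq> \<one>" "x \<otimes> x = \<one>"
  shows "homogeneous_subgroup G k (generate G {g})"
    and "c \<in> generate G {g} \<Longrightarrow> c \<otimes> c = \<one> \<Longrightarrow> c = \<one> \<or> c = x"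
proof -
  have xc: "x \<in> carrier G" using g top(1) by auto
  have "g [^] ((2::nat) ^ Suc k) = \<one>"
    using g top(1,3) square_pow[OF g] nat_pow_distrib[OF g g] by metis
  then have "ord g dvd 2 ^ Suc k" using g pow_eq_id by blast
  moreover have "\<not> ord g dvd 2 ^ k" using g top pow_eq_id by metis
  ultimately have ord: "ord g = 2 ^ Suc k"
    by (metis divides_primepow_nat two_is_prime_nat le_SucE le_imp_power_dvd)
  have C_eq: "generate G {g} = {g [^] (i::int) | i. i \<in> UNIV}" using generate_pow g by blast
  have soc: "\<exists>j::int. c = x [^] j \<and> (g [^] j) [^] ((2::nat) ^ k) = c"
    if "c \<in> generate G {g}" "c \<otimes> c = \<one>" for c
  proof -
    obtain i :: int where i: "c = g [^] i" using \<open>c \<in> generate G {g}\<close> C_eq by auto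
    have "g [^] (2 * i) = \<one>" using that(2) g unfolding i mult_2 by (simp only: int_pow_mult)
    then have "int (2 ^ Suc k) dvd 2 * i" using int_pow_eq_id g ord by metis
    then have "2 ^ k dvd i" by simp
    then obtain j where j: "i = 2 ^ k * j" by blast
    have "g [^] (2 ^ k :: int) = x" using top(1) int_pow_int[of G g "2 ^ k"] by simp
    then have "c = x [^] j" using int_pow_pow[OF g, of "2 ^ k" j] by (simp add: i j)
    moreover have "(g [^] j) [^] ((2::nat) ^ k) = c"
      using int_pow_pow[OF g, of j "2 ^ k"] int_pow_int[of G "g [^] j" "2 ^ k"]
      by (simp add: i j mult.commute)
    ultimately show ?thesis by blast
  qed
  show "homogeneous_subgroup G k (generate G {g})"
    unfolding homogeneous_subgroup_def
    using soc C_eq g generate_is_subgroup[of "{g}"] by blast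
  show "c = \<one> \<or> c = x" if c: "c \<in> generate G {g}" "c \<otimes> c = \<one>"
  proof -
    obtain j :: int where j: "c = x [^] j" using soc[OF c] by blast
    have x2: "x [^] (2::int) = \<one>" using top(3) xc int_pow_int[of G x 2] by (simp add: numeral_2_eq_2)
    have "x [^] j = x [^] (2 * (j div 2)) \<otimes> x [^] (j mod 2)"
      using xc by (simp flip: int_pow_mult)
    also have "x [^] (2 * (j div 2)) = \<one>"
      using x2 xc by (simp flip: int_pow_pow)
    finally have "x [^] j = x [^] (j mod 2)" using xc by simp
    moreover have "j mod 2 = 0 \<or> j mod 2 = 1" by presburger
    ultimately show ?thesis using j xc by auto
  qed
qed

text \<open>
  A maximal homogeneous subgroup with socle inside \<open>X\<close> has all of \<open>X\<close> as its socle: for a missing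
  \<open>x = 2\<^sup>k g\<close>, the cyclic group generated by \<open>g\<close> would be an independent homogeneous summand to add.
\<close>

lemma homogeneous_lift:
  assumes fin: "finite (carrier G)" and X: "subgroup X G"
    and exp: "\<And>x. x \<in> carrier G \<Longrightarrow> x [^] ((2::nat) ^ Suc k) = \<one>"
    and X_sq: "\<And>x. x \<in> X \<Longrightarrow> x \<otimes> x = \<one>"
    and X_ht: "\<And>x. x \<in> X \<Longrightarrow> \<exists>g \<in> carrier G. g [^] ((2::nat) ^ k) = x"
  obtains A where "homogeneous_subgroup G k A" "{x \<in> A. x \<otimes> x = \<one>} = X"
proof -
  interpret X: subgroup X G by fact
  define F where "F = {A. homogeneous_subgroup G k A \<and> {x \<in> A. x \<otimes> x = \<one>} \<subseteq> X}"
  have "F \<subseteq> Pow (carrier G)"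
    unfolding F_def homogeneous_subgroup_def by (auto dest: subgroup.mem_carrier)
  then have "finite F" using fin finite_subset by blast
  moreover have "{\<one>} \<in> F"
    using triv_subgroup X.one_closed by (auto simp: F_def homogeneous_subgroup_def)
  ultimately obtain A where A: "A \<in> F" and max: "\<And>B. B \<in> F \<Longrightarrow> A \<subseteq> B \<Longrightarrow> B = A"
    by (metis finite_has_maximal empty_iff)
  have hA: "homogeneous_subgroup G k A" and A_X: "{x \<in> A. x \<otimes> x = \<one>} \<subseteq> X"
    using A by (auto simp: F_def)
  interpret A: subgroup A G using hA by (simp add: homogeneous_subgroup_def)
  have "x \<in> A" if x: "x \<in> X" for x
  proof (rule ccontr)
    assume xA: "x \<notin> A"
    then have x1: "x \<noteq> \<one>" using A.one_closed by blast
    obtain g where g: "g \<in> carrier G" "g [^] ((2::nat) ^ k) = x" using X_ht[OF x] by blast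
    define C where "C = generate G {g}"
    have gC: "g \<in> C" unfolding C_def by (auto intro: generate.incl)
    have hC: "homogeneous_subgroup G k C"
      and C_soc: "\<And>c. c \<in> C \<Longrightarrow> c \<otimes> c = \<one> \<Longrightarrow> c = \<one> \<or> c = x"
      unfolding C_def using homogeneous_cyclic[OF g x1 X_sq[OF x]] by blast+
    interpret C: subgroup C G using hC by (simp add: homogeneous_subgroup_def)
    have int: "A \<inter> C = {\<one>}"
      by (rule trivial_int_from_socle[OF A.subgroup_axioms C.subgroup_axioms exp]) (use C_soc xA in auto)
    have "A <#> C \<in> F"
      unfolding F_def
    proof (safe intro!: homogeneous_direct_product hA hC int)
      fix z assume "z \<in> A <#> C" "z \<otimes> z = \<one>"
      then obtain \<alpha> c where "\<alpha> \<in> A" "c \<in> C" "z = \<alpha> \<otimes> c" "\<alpha> \<otimes> \<alpha> = \<one>" "c \<otimes> c = \<one>"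
        by (rule socle_of_direct_product[OF A.subgroup_axioms C.subgroup_axioms int])
      then have "\<alpha> \<in> X" "c \<in> X" "z = \<alpha> \<otimes> c" using A_X C_soc x X.one_closed by blast+
      then show "z \<in> X" by simp
    qed
    moreover have "A \<subseteq> A <#> C"
      using A.subgroup_axioms C.subgroup_axioms by (rule subset_set_mult)
    ultimately have "A <#> C = A" by (rule max)
    moreover have "\<one> \<otimes> x \<in> A <#> C"
      using A.one_closed nat_pow_closed_subgroup[OF C.subgroup_axioms gC, of "2 ^ k"]
      unfolding set_mult_def g(2) by blast
    ultimately show False using xA x by simp
  qed
  then show ?thesis using that[of A] hA A_X X_sq by blast
qed

text \<open>
  An element of a direct sum of cyclic groups of order \<open>2\<^sup>k\<^sup>+\<^sup>1\<close> is divisible by \<open>2\<close> as soon as it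
  is killed by \<open>2\<^sup>k\<close>. The induction on the order of \<open>x\<close> subtracts an element \<open>r + r\<close> with the
  same leading term \<open>2\<^sup>m x\<close> as \<open>x\<close>.
\<close>

lemma homogeneous_halvable:
  assumes H: "homogeneous_subgroup G k H"
    and x: "x \<in> H" "x [^] ((2::nat) ^ k) = \<one>"
  shows "\<exists>h \<in> H. x = h \<otimes> h"
proof -
  interpret H: subgroup H G using H by (simp add: homogeneous_subgroup_def)
  have "\<exists>h \<in> H. x = h \<otimes> h" if "x \<in> H" "x [^] ((2::nat) ^ m) = \<one>" "m \<le> k" for x m
    using that
  proof (induction m arbitrary: x)
    case 0
    then show ?case using H.one_closed by (intro bexI[of _ \<one>]) auto
  next
    case (Suc m)
    have xc: "x \<in> carrier G" using Suc.prems H.mem_carrier by blast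
    define y where "y = x [^] ((2::nat) ^ m)"
    note pw = nat_pow_closed_subgroup[OF H.subgroup_axioms]
    have "y \<otimes> y = \<one>"
      using Suc.prems(2) square_pow[OF xc] xc by (simp only: y_def nat_pow_distrib)
    with pw[OF Suc.prems(1)] H obtain g where g: "g \<in> H" "g [^] ((2::nat) ^ k) = y"
      unfolding y_def homogeneous_subgroup_def by blast
    have gc: "g \<in> carrier G" using g by simp
    define r where "r = g [^] ((2::nat) ^ (k - Suc m))"
    have r: "r \<in> H" "r \<in> carrier G" using pw g gc by (auto simp: r_def)
    have "(r \<otimes> r) [^] ((2::nat) ^ m) = g [^] ((2::nat) ^ (k - Suc m) * 2 ^ Suc m)"
      unfolding square_pow[OF r(2)] unfolding r_def using gc by (rule nat_pow_pow)
    also have "\<dots> = y"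
      using g Suc.prems(3) by (simp del: power_Suc flip: power_add)
    finally have rr: "(r \<otimes> r) [^] ((2::nat) ^ m) = y" .
    define z where "z = x \<otimes> inv (r \<otimes> r)"
    have "z [^] ((2::nat) ^ m) = y \<otimes> inv y"
      using nat_pow_distrib[of x "inv (r \<otimes> r)"] nat_pow_inv[of "r \<otimes> r"] xc r rr
      by (simp only: z_def y_def m_closed inv_closed)
    then have "z [^] ((2::nat) ^ m) = \<one>" using xc by (simp add: y_def)
    moreover have "z \<in> H" using Suc.prems r by (simp add: z_def)
    ultimately obtain h where h: "h \<in> H" "z = h \<otimes> h" using Suc by fastforce
    have "x = z \<otimes> (r \<otimes> r)" using xc r by (simp add: z_def m_assoc)
    then have "x = (h \<otimes> r) \<otimes> (h \<otimes> r)" using h r by (simp add: m_ac)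
    then show ?case using h r by blast
  qed
  from this[OF x] show ?thesis by simp
qed

text \<open>
  Homogeneous subgroups whose exponent is that of the whole group are injective relative to it. A
  subgroup \<open>K\<close> maximal with \<open>H \<inter> K = 0\<close> is a complement: if \<open>2 x = h + c\<close> with \<open>h\<close> in \<open>H\<close> and
  \<open>c\<close> in \<open>K\<close>, then \<open>2\<^sup>k h = 0\<close>, so \<open>h\<close> can be halved, and after a shift of \<open>x\<close> by an element of \<open>H\<close> one
  may assume \<open>2 x = c\<close>. Then \<open>K\<close> together with \<open>x\<close> still meets \<open>H\<close> trivially unless \<open>x\<close> lies in \<open>H + K\<close>.
\<close>

lemma homogeneous_complement:
  assumes fin: "finite (carrier G)" and H: "homogeneous_subgroup G k H"
    and exp: "\<And>x. x \<in> carrier G \<Longrightarrow> x [^] ((2::nat) ^ Suc k) = \<one>"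
  obtains K where "subgroup K G" "H \<inter> K = {\<one>}" "H <#> K = carrier G"
proof -
  interpret H: subgroup H G using H by (simp add: homogeneous_subgroup_def)
  define F where "F = {K. subgroup K G \<and> H \<inter> K = {\<one>}}"
  have "F \<subseteq> Pow (carrier G)" unfolding F_def by (auto dest: subgroup.mem_carrier)
  then have "finite F" using fin finite_subset by blast
  moreover have "{\<one>} \<in> F" using triv_subgroup by (auto simp: F_def)
  ultimately obtain K where K: "K \<in> F" and max: "\<And>B. B \<in> F \<Longrightarrow> K \<subseteq> B \<Longrightarrow> B = K"
    by (metis finite_has_maximal empty_iff)
  interpret K: subgroup K G using K by (simp add: F_def)
  have HK: "H \<inter> K = {\<one>}" using K by (simp add: F_def)
  define P where "P = H <#> K"
  have P: "subgroup P G" unfolding P_def using H.subgroup_axioms K.subgroup_axioms by (rule mult_subgroups)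
  interpret P: subgroup P G by (rule P)
  have step: "x \<in> P" if x: "x \<in> carrier G" and xx: "x \<otimes> x \<in> P" for x
  proof (rule ccontr)
    assume xP: "x \<notin> P"
    obtain h c where hc: "h \<in> H" "c \<in> K" "x \<otimes> x = h \<otimes> c"
      using xx unfolding P_def set_mult_def by blast
    have "(x \<otimes> x) [^] ((2::nat) ^ k) = \<one>"
      using exp[OF x] square_pow[OF x] by simp
    then have e: "h [^] ((2::nat) ^ k) \<otimes> c [^] ((2::nat) ^ k) = \<one>"
      using hc by (simp add: nat_pow_distrib)
    have "h [^] ((2::nat) ^ k) = inv (c [^] ((2::nat) ^ k))"
      using e hc inv_equality[of "h [^] ((2::nat) ^ k)" "c [^] ((2::nat) ^ k)"] by simp
    then have "h [^] ((2::nat) ^ k) \<in> H \<inter> K" using hc nat_pow_closed_subgroup H.subgroup_axioms K.subgroup_axioms by (metis IntI K.m_inv_closed)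
    then have "h [^] ((2::nat) ^ k) = \<one>" using HK by simp
    from homogeneous_halvable[OF H hc(1) this] obtain r where r: "r \<in> H" "h = r \<otimes> r" by blast
    \<comment> \<open>The shifted element \<open>y\<close> satisfies \<open>2 y = c\<close>, so the subgroup
      generated by \<open>K\<close> and \<open>y\<close> is the union of \<open>K\<close> and \<open>y + K\<close>.\<close>
    define y where "y = x \<otimes> inv r"
    have yc: "y \<in> carrier G" using x r by (simp add: y_def)
    have "y \<otimes> y = (x \<otimes> x) \<otimes> inv (r \<otimes> r)"
      using x r by (simp add: y_def m_ac inv_mult)
    then have yy: "y \<otimes> y = c" using hc r by (simp add: m_ac)
    have HP: "u \<in> H \<Longrightarrow> u \<in> P" and KP: "u \<in> K \<Longrightarrow> u \<in> P" for u
      using subset_set_mult[OF H.subgroup_axioms K.subgroup_axioms] by (auto simp: P_def)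
    have "y \<notin> P"
    proof
      assume "y \<in> P"
      then have "y \<otimes> r \<in> P" using HP r by simp
      then show False using xP x r by (simp add: y_def m_assoc)
    qed
    define K' where "K' = K \<union> (\<lambda>c. y \<otimes> c) ` K"
    have "subgroup K' G"
    proof (rule subgroupI)
      show "K' \<subseteq> carrier G" using yc by (auto simp: K'_def)
      show "K' \<noteq> {}" using K.one_closed unfolding K'_def by blast
    next
      fix u assume "u \<in> K'"
      then consider "u \<in> K" | d where "d \<in> K" "u = y \<otimes> d" by (auto simp: K'_def)
      then show "inv u \<in> K'"
      proof cases
        case 2
        have "inv u = y \<otimes> (inv (y \<otimes> y) \<otimes> inv d)"
          using 2 yc by (simp add: inv_mult m_assoc mult_inv_cancel)
        then show ?thesis using 2 yy hc by (auto simp: K'_def)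
      qed (auto simp: K'_def)
    next
      fix u u' assume "u \<in> K'" "u' \<in> K'"
      then obtain d d' where d: "d \<in> K" "d' \<in> K" "u = d \<or> u = y \<otimes> d" "u' = d' \<or> u' = y \<otimes> d'"
        unfolding K'_def by blast
      have "y \<otimes> d \<otimes> (y \<otimes> d') = (y \<otimes> y) \<otimes> (d \<otimes> d')" using d yc by (simp add: m_ac)
      then have "y \<otimes> d \<otimes> (y \<otimes> d') = c \<otimes> (d \<otimes> d')" unfolding yy .
      moreover have "y \<otimes> d \<otimes> d' = y \<otimes> (d \<otimes> d')" "d \<otimes> (y \<otimes> d') = y \<otimes> (d \<otimes> d')"
        using d yc by (simp_all add: m_assoc m_lcomm)
      ultimately show "u \<otimes> u' \<in> K'" using d hc unfolding K'_def by auto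
    qed
    moreover have "H \<inter> K' = {\<one>}"
    proof -
      have "y \<otimes> d \<notin> H" if "d \<in> K" for d
      proof
        assume "y \<otimes> d \<in> H"
        then have "y \<otimes> d \<otimes> inv d \<in> P" using HP KP that by (intro P.m_closed[of "y \<otimes> d"]) simp_all
        then show False using \<open>y \<notin> P\<close> yc that by (simp add: m_assoc)
      qed
      then show ?thesis using HK unfolding K'_def by auto
    qed
    ultimately have "K' = K" by (intro max) (auto simp: F_def K'_def)
    moreover have "y \<otimes> \<one> \<in> K'" using K.one_closed unfolding K'_def by blast
    ultimately show False using yc KP \<open>y \<notin> P\<close> by auto
  qed
  have "x \<in> P" if "x \<in> carrier G" "x [^] ((2::nat) ^ j) = \<one>" for x j
    using that
  proof (induction j arbitrary: x)
    case 0
    then show ?case by simp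
  next
    case (Suc j)
    have "(x \<otimes> x) [^] ((2::nat) ^ j) = \<one>"
      using Suc.prems(2) square_pow[OF Suc.prems(1)] by simp
    then have "x \<otimes> x \<in> P" using Suc.prems(1) by (intro Suc.IH m_closed)
    then show ?case by (rule step[OF Suc.prems(1)])
  qed
  then have "P = carrier G" using exp P.subset by blast
  then show ?thesis using that K.subgroup_axioms HK by (simp add: P_def)
qed

lemma direct_projection:
  assumes H: "subgroup H G" and K: "subgroup K G"
    and int: "H \<inter> K = {\<one>}" and prod: "H <#> K = carrier G"
  obtains \<pi> where "\<pi> \<in> hom G G" "\<And>x. x \<in> carrier G \<Longrightarrow> \<pi> x \<in> K"
    "\<And>x. x \<in> H \<Longrightarrow> \<pi> x = \<one>" "\<And>x. x \<in> K \<Longrightarrow> \<pi> x = x"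
    "\<And>x. x \<in> carrier G \<Longrightarrow> x \<otimes> inv \<pi> x \<in> H"
proof -
  interpret H: subgroup H G by fact
  interpret K: subgroup K G by fact
  have uniq: "y = y'" if "y \<in> K" "y' \<in> K" "x \<otimes> inv y \<in> H" "x \<otimes> inv y' \<in> H" "x \<in> carrier G" for x y y'
  proof -
    have "inv (x \<otimes> inv y) \<otimes> (x \<otimes> inv y') = y \<otimes> inv y'"
      using that by (simp add: inv_mult_group m_assoc) (simp flip: m_assoc)
    moreover have "inv (x \<otimes> inv y) \<otimes> (x \<otimes> inv y') \<in> H" using that by auto
    ultimately have "y \<otimes> inv y' \<in> H \<inter> K" using that by auto
    then have "y \<otimes> inv y' = \<one>" using int by simp
    then show ?thesis using that by (metis K.mem_carrier inv_closed inv_equality inv_inv)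
  qed
  have ex: "\<exists>y. y \<in> K \<and> x \<otimes> inv y \<in> H" if "x \<in> carrier G" for x
  proof -
    have "x \<in> H <#> K" using that prod by simp
    then obtain h c where "h \<in> H" "c \<in> K" "x = h \<otimes> c" unfolding set_mult_def by blast
    then show ?thesis by (intro exI[of _ c]) (simp add: m_assoc)
  qed
  define \<pi> where "\<pi> x = (SOME y. y \<in> K \<and> x \<otimes> inv y \<in> H)" for x
  have pi: "\<pi> x \<in> K" "x \<otimes> inv \<pi> x \<in> H" if "x \<in> carrier G" for x
    using someI_ex[OF ex[OF that]] unfolding \<pi>_def by blast+
  have eq: "\<pi> x = y" if "x \<in> carrier G" "y \<in> K" "x \<otimes> inv y \<in> H" for x y
    using uniq[of "\<pi> x" y x] pi that by blast
  show ?thesis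
  proof (rule that[of \<pi>])
    show "\<pi> \<in> hom G G"
    proof (rule homI)
      fix x y assume xy: "x \<in> carrier G" "y \<in> carrier G"
      have "x \<otimes> y \<otimes> inv (\<pi> x \<otimes> \<pi> y) = (x \<otimes> inv \<pi> x) \<otimes> (y \<otimes> inv \<pi> y)"
        using xy pi by (simp add: inv_mult m_ac)
      then show "\<pi> (x \<otimes> y) = \<pi> x \<otimes> \<pi> y"
        using xy pi by (intro eq) auto
    qed (use pi in auto)
  qed (auto intro!: pi eq)
qed

end

section \<open>Endomorphisms of finite 2-groups\<close>

text \<open>
  On a finite group this is nil-cleanness of \<open>a\<close> in the endomorphism ring, because local nilpotency is
  then nilpotency. The functions may take any values outside the carrier, so that restrictions do not
  clutter the induction.
\<close>

definition nil_clean_endo :: "('a, 'b) monoid_scheme \<Rightarrow> ('a \<Rightarrow> 'a) \<Rightarrow> bool" where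
  "nil_clean_endo G a \<longleftrightarrow> (\<exists>e \<in> hom G G. \<exists>t \<in> hom G G.
    (\<forall>x\<in>carrier G. a x = e x \<otimes>\<^bsub>G\<^esub> t x) \<and> (\<forall>x\<in>carrier G. e (e x) = e x) \<and>
    (\<forall>x\<in>carrier G. \<exists>n. (t ^^ n) x = \<one>\<^bsub>G\<^esub>))"

context comm_group
begin

lemma power_image_subgroup: "subgroup ((\<lambda>g. g [^] (n::nat)) ` carrier G) G"
proof (rule subgroupI)
  fix x y assume "x \<in> (\<lambda>g. g [^] n) ` carrier G" "y \<in> (\<lambda>g. g [^] n) ` carrier G"
  then obtain g h where gh: "g \<in> carrier G" "h \<in> carrier G" "x = g [^] n" "y = h [^] n" by blast
  then show "x \<otimes> y \<in> (\<lambda>g. g [^] n) ` carrier G"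
    by (intro image_eqI[of _ _ "g \<otimes> h"]) (simp_all add: nat_pow_distrib)
  show "inv x \<in> (\<lambda>g. g [^] n) ` carrier G"
    using gh by (intro image_eqI[of _ _ "inv g"]) (simp_all add: nat_pow_inv)
qed auto

text \<open>
  The inductive step. With \<open>W = M \<oplus> S\<close> as in the splitting of a cyclic block of \<open>2\<^sup>k G\<close>, the group
  is decomposed as \<open>G = A \<oplus> B \<oplus> K\<close> with socles \<open>M\<close> and \<open>S\<close> of \<open>A\<close> and \<open>B\<close>. The maps
  \<open>\<rho>\<close> and \<open>\<pi>\<close> are the projections onto \<open>B\<close> and \<open>K\<close>. The summand \<open>K\<close> need not be invariant under
  \<open>a\<close>, so the induction hypothesis is applied to \<open>\<pi> \<circ> a\<close>. On the socle of \<open>K\<close>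
  the component of \<open>a\<close> outside \<open>K\<close> lies in \<open>W\<close>, where \<open>t\<close> is nilpotent.
\<close>

lemma nil_clean_endo_step:
  assumes fin: "finite (carrier G)" and nontriv: "carrier G \<noteq> {\<one>}"
    and exp: "\<And>x. x \<in> carrier G \<Longrightarrow> x [^] ((2::nat) ^ N) = \<one>"
    and a: "a \<in> hom G G"
    and IH: "\<And>K b. subgroup K G \<Longrightarrow> card K < card (carrier G) \<Longrightarrow>
      b \<in> hom (G\<lparr>carrier := K\<rparr>) (G\<lparr>carrier := K\<rparr>) \<Longrightarrow> nil_clean_endo (G\<lparr>carrier := K\<rparr>) b"
  shows "nil_clean_endo G a"
proof -
  \<comment> \<open>\<open>Nm = k + 1\<close> is exact: \<open>2\<^sup>k G\<close> is nonzero, so that it contains the vector starting an orbit.\<close>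
  define Nm where "Nm = (LEAST n. \<forall>x\<in>carrier G. x [^] ((2::nat) ^ n) = \<one>)"
  have Nm: "\<forall>x\<in>carrier G. x [^] ((2::nat) ^ Nm) = \<one>"
    unfolding Nm_def by (rule LeastI[of _ N]) (use exp in blast)
  have "Nm \<noteq> 0"
  proof
    assume "Nm = 0"
    then have "\<forall>x\<in>carrier G. x = \<one>" using Nm by simp
    then show False using nontriv one_closed by blast
  qed
  then obtain k where k: "Nm = Suc k" by (cases Nm) auto
  have exp': "x [^] ((2::nat) ^ Suc k) = \<one>" if "x \<in> carrier G" for x
    using Nm that unfolding k by blast
  have "\<not> (\<forall>x\<in>carrier G. x [^] ((2::nat) ^ k) = \<one>)"
    using not_less_Least[of k "\<lambda>n. \<forall>x\<in>carrier G. x [^] ((2::nat) ^ n) = \<one>"] k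
    unfolding Nm_def by auto
  then obtain g0 where g0: "g0 \<in> carrier G" "g0 [^] ((2::nat) ^ k) \<noteq> \<one>" by blast
  define U where "U = (\<lambda>g. g [^] ((2::nat) ^ k)) ` carrier G"
  have "elementary_endo G U a (g0 [^] ((2::nat) ^ k))"
  proof (intro elementary_endo.intro elementary_endo_axioms.intro comm_group_axioms a)
    show "subgroup U G" unfolding U_def by (rule power_image_subgroup)
    show "x \<otimes> x = \<one>" if x: "x \<in> U" for x
    proof -
      obtain g where g: "g \<in> carrier G" "x = g [^] ((2::nat) ^ k)" using x unfolding U_def by blast
      then show ?thesis
        using exp'[OF g(1)] square_pow[OF g(1)] nat_pow_distrib[OF g(1) g(1)] by metis
    qed
    show "a x \<in> U" if "x \<in> U" for x
      using that hom_nat_pow_apply[OF a] hom_in_carrier[OF a] unfolding U_def by auto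
    show "g0 [^] ((2::nat) ^ k) \<in> U" using g0 unfolding U_def by blast
  qed
  then interpret E: elementary_endo G U a "g0 [^] ((2::nat) ^ k)" .
  have finU: "finite U" unfolding U_def using fin by simp
  from E.nil_clean_splitting_exists[OF finU g0(2)] obtain M S where good: "E.nil_clean_splitting M S" by blast
  have M: "subgroup M G" and S: "subgroup S G" and MS: "M \<subseteq> U" "S \<subseteq> U" "M \<inter> S = {\<one>}" "M \<union> S \<noteq> {\<one>}"
    using good unfolding E.nil_clean_splitting_def by blast+
  have good_t: "M \<union> S \<subseteq> locally_nilpotent_part G t"
    if "t \<in> hom G G" "\<And>m. m \<in> M \<Longrightarrow> t m = a m" "\<And>s. s \<in> S \<Longrightarrow> t s \<otimes> s = a s" for t
    using good that unfolding E.nil_clean_splitting_def by blast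
  have U_ht: "\<exists>g\<in>carrier G. g [^] ((2::nat) ^ k) = x" if "x \<in> U" for x using that unfolding U_def by blast
  have M_U: "x \<in> M \<Longrightarrow> x \<otimes> x = \<one>" "x \<in> M \<Longrightarrow> \<exists>g\<in>carrier G. g [^] ((2::nat) ^ k) = x"
    and S_U: "x \<in> S \<Longrightarrow> x \<otimes> x = \<one>" "x \<in> S \<Longrightarrow> \<exists>g\<in>carrier G. g [^] ((2::nat) ^ k) = x" for x
    using E.sq U_ht MS by blast+
  obtain A where hA: "homogeneous_subgroup G k A" and A_soc: "{x \<in> A. x \<otimes> x = \<one>} = M"
    by (rule homogeneous_lift[where k = k, OF fin M exp' M_U])
  obtain B where hB: "homogeneous_subgroup G k B" and B_soc: "{x \<in> B. x \<otimes> x = \<one>} = S"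
    by (rule homogeneous_lift[where k = k, OF fin S exp' S_U])
  have A_M: "x \<in> A \<Longrightarrow> x \<otimes> x = \<one> \<Longrightarrow> x \<in> M" "x \<in> M \<Longrightarrow> x \<in> A"
    and B_S: "x \<in> B \<Longrightarrow> x \<otimes> x = \<one> \<Longrightarrow> x \<in> S" "x \<in> S \<Longrightarrow> x \<in> B" for x
    unfolding A_soc[symmetric] B_soc[symmetric] by simp_all
  interpret A: subgroup A G using hA by (simp add: homogeneous_subgroup_def)
  interpret B: subgroup B G using hB by (simp add: homogeneous_subgroup_def)
  have AB: "A \<inter> B = {\<one>}"
  proof (rule trivial_int_from_socle[OF A.subgroup_axioms B.subgroup_axioms exp])
    fix x assume "x \<in> A" "x \<in> B" "x \<otimes> x = \<one>"
    then have "x \<in> M \<inter> S" using A_M(1) B_S(1) by simp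
    then show "x = \<one>" using MS(3) by simp
  qed
  define H where "H = A <#> B"
  have hH: "homogeneous_subgroup G k H"
    unfolding H_def by (rule homogeneous_direct_product[OF hA hB AB])
  interpret H: subgroup H G using hH by (simp add: homogeneous_subgroup_def)
  have AH: "x \<in> A \<Longrightarrow> x \<in> H" and BH: "x \<in> B \<Longrightarrow> x \<in> H" for x
    using subset_set_mult[OF A.subgroup_axioms B.subgroup_axioms] by (auto simp: H_def)
  obtain K where K: "subgroup K G" and HK: "H \<inter> K = {\<one>}" "H <#> K = carrier G"
    by (rule homogeneous_complement[OF fin hH exp'])
  interpret K: subgroup K G by (rule K)
  have "\<not> H \<subseteq> {\<one>}"
  proof
    assume "H \<subseteq> {\<one>}"
    moreover have "M \<union> S \<subseteq> H"
    proof
      show "x \<in> H" if "x \<in> M \<union> S" for x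
        using that AH[of x] BH[of x] A_M(2)[of x] B_S(2)[of x] by auto
    qed
    ultimately have "M \<union> S \<subseteq> {\<one>}" by blast
    moreover have "\<one> \<in> M" using subgroup.one_closed[OF M] .
    ultimately show False using MS(4) by auto
  qed
  then have "K \<noteq> carrier G" using HK(1) H.subset by auto
  then have cardK: "card K < card (carrier G)"
    using K.subset fin by (intro psubset_card_mono) auto
  obtain \<pi> where \<pi>: "\<pi> \<in> hom G G" and \<pi>_K: "\<And>x. x \<in> carrier G \<Longrightarrow> \<pi> x \<in> K"
    and \<pi>_H: "\<And>x. x \<in> H \<Longrightarrow> \<pi> x = \<one>" and \<pi>_id: "\<And>x. x \<in> K \<Longrightarrow> \<pi> x = x"
    and \<pi>_diff: "\<And>x. x \<in> carrier G \<Longrightarrow> x \<otimes> inv \<pi> x \<in> H"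
    by (rule direct_projection[OF H.subgroup_axioms K HK]) blast
  have AK_sub: "subgroup (A <#> K) G" by (rule mult_subgroups[OF A.subgroup_axioms K])
  have AK_B: "(A <#> K) \<inter> B = {\<one>}"
  proof -
    have "x = \<one>" if x: "x \<in> A <#> K" "x \<in> B" for x
    proof -
      obtain \<alpha> \<kappa> where c: "\<alpha> \<in> A" "\<kappa> \<in> K" "x = \<alpha> \<otimes> \<kappa>" using x unfolding set_mult_def by blast
      then have "\<kappa> = inv \<alpha> \<otimes> x" using inv_solve_left by simp
      moreover have "inv \<alpha> \<otimes> x \<in> H"
        using AH[OF c(1)] BH[OF x(2)] by (intro H.m_closed H.m_inv_closed)
      ultimately have "\<kappa> \<in> H \<inter> K" using c(2) by simp
      then have "\<kappa> = \<one>" using HK(1) by simp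
      then have "x \<in> A \<inter> B" using c x by simp
      then show "x = \<one>" using AB by simp
    qed
    then show ?thesis using subgroup.one_closed[OF AK_sub] B.one_closed by blast
  qed
  have "x \<in> (A <#> K) <#> B" if x: "x \<in> carrier G" for x
  proof -
    obtain \<alpha> \<beta> \<kappa> where c: "\<alpha> \<in> A" "\<beta> \<in> B" "\<kappa> \<in> K" "x = \<alpha> \<otimes> \<beta> \<otimes> \<kappa>"
      using x HK(2) unfolding H_def set_mult_def by blast
    then have "x = \<alpha> \<otimes> \<kappa> \<otimes> \<beta>" by (simp add: m_ac)
    then show ?thesis using c unfolding set_mult_def by blast
  qed
  then have AK_B_prod: "(A <#> K) <#> B = carrier G"
    using subgroup.subset[OF mult_subgroups[OF AK_sub B.subgroup_axioms]] by blast
  obtain \<rho> where \<rho>: "\<rho> \<in> hom G G" and \<rho>_B: "\<And>x. x \<in> carrier G \<Longrightarrow> \<rho> x \<in> B"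
    and \<rho>_AK: "\<And>x. x \<in> A <#> K \<Longrightarrow> \<rho> x = \<one>" and \<rho>_id: "\<And>x. x \<in> B \<Longrightarrow> \<rho> x = x"
    by (rule direct_projection[OF AK_sub B.subgroup_axioms AK_B AK_B_prod]) blast
  have \<rho>_A: "x \<in> A \<Longrightarrow> \<rho> x = \<one>" and \<rho>_K: "x \<in> K \<Longrightarrow> \<rho> x = \<one>" for x
    using \<rho>_AK subset_set_mult[OF A.subgroup_axioms K] by auto
  note closed = hom_in_carrier[of _ G G] and mult = hom_mult[of _ G G]
  have "(\<lambda>x. \<pi> (a x)) \<in> hom (G\<lparr>carrier := K\<rparr>) (G\<lparr>carrier := K\<rparr>)"
    by (rule homI) (simp_all add: \<pi>_K closed[OF a] mult[OF a] mult[OF \<pi>])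
  from IH[OF K cardK this] obtain e' t' where
    e': "e' \<in> hom (G\<lparr>carrier := K\<rparr>) (G\<lparr>carrier := K\<rparr>)" and
    t': "t' \<in> hom (G\<lparr>carrier := K\<rparr>) (G\<lparr>carrier := K\<rparr>)" and
    et': "\<And>x. x \<in> K \<Longrightarrow> \<pi> (a x) = e' x \<otimes> t' x" and e'_idem: "\<And>x. x \<in> K \<Longrightarrow> e' (e' x) = e' x" and
    t'_nil: "\<And>x. x \<in> K \<Longrightarrow> \<exists>n. (t' ^^ n) x = \<one>"
    unfolding nil_clean_endo_def by auto
  note K_closed = hom_in_carrier[of _ "G\<lparr>carrier := K\<rparr>" "G\<lparr>carrier := K\<rparr>", simplified]
    and K_mult = hom_mult[of _ "G\<lparr>carrier := K\<rparr>" "G\<lparr>carrier := K\<rparr>", simplified]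
  have K_one: "f \<one> = \<one>" if "f \<in> hom (G\<lparr>carrier := K\<rparr>) (G\<lparr>carrier := K\<rparr>)" for f
  proof -
    have "f \<one> \<otimes> f \<one> = f \<one> \<otimes> \<one>"
      using K_mult[OF that K.one_closed K.one_closed] K_closed[OF that K.one_closed] by simp
    then show ?thesis using K_closed[OF that K.one_closed] by simp
  qed
  note e'_c = K_closed[OF e'] and t'_c = K_closed[OF t']
  define e where "e x = \<rho> x \<otimes> e' (\<pi> x)" for x
  have e: "e \<in> hom G G"
  proof (rule homI)
    show "e x \<in> carrier G" if "x \<in> carrier G" for x
      using \<rho>_B[OF that] e'_c[OF \<pi>_K[OF that]] by (simp add: e_def)
    show "e (x \<otimes> y) = e x \<otimes> e y" if "x \<in> carrier G" "y \<in> carrier G" for x y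
    proof -
      have "\<rho> x \<in> carrier G" "\<rho> y \<in> carrier G" using \<rho>_B that by auto
      moreover have "e' (\<pi> x) \<in> carrier G" "e' (\<pi> y) \<in> carrier G" using e'_c \<pi>_K that by auto
      ultimately show ?thesis
        using that by (simp add: e_def mult[OF \<rho>] mult[OF \<pi>] K_mult[OF e'] \<pi>_K m_ac)
    qed
  qed
  have e_K: "e x = e' x" if "x \<in> K" for x
    using that \<rho>_K \<pi>_id e'_c by (simp add: e_def)
  have e_A: "e x = \<one>" if "x \<in> A" for x
    using that \<rho>_A \<pi>_H AH K_one[OF e'] by (simp add: e_def)
  have e_B: "e x = x" if "x \<in> B" for x
    using that \<rho>_id \<pi>_H BH K_one[OF e'] by (simp add: e_def)
  have e_idem: "e (e x) = e x" if x: "x \<in> carrier G" for x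
  proof -
    have r: "\<rho> x \<in> B" "e' (\<pi> x) \<in> K" using \<rho>_B \<pi>_K e'_c x by auto
    then have "e (e x) = e (\<rho> x) \<otimes> e (e' (\<pi> x))"
      unfolding e_def[of x] by (intro mult[OF e]) auto
    also have "\<dots> = \<rho> x \<otimes> e' (\<pi> x)" using r e_B e_K e'_idem \<pi>_K x by simp
    finally show ?thesis by (simp add: e_def)
  qed
  define t where "t x = a x \<otimes> inv e x" for x
  note a_c = closed[OF a] and e_c = closed[OF e]
  have t: "t \<in> hom G G"
    by (rule homI) (simp_all add: t_def a_c e_c mult[OF a] mult[OF e] inv_mult m_ac)
  have ae: "a x = e x \<otimes> t x" if "x \<in> carrier G" for x
    using that a_c[OF that] e_c[OF that] by (simp add: t_def m_ac)
  interpret L: subgroup "locally_nilpotent_part G t" G by (rule locally_nilpotent_subgroup[OF t])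
  have MS_L: "M \<union> S \<subseteq> locally_nilpotent_part G t"
  proof (rule good_t[OF t])
    show "t m = a m" if "m \<in> M" for m
      using that A_M e_A a_c by (auto simp: t_def)
    show "t s \<otimes> s = a s" if "s \<in> S" for s
    proof -
      have "s \<in> B" using that B_S by blast
      then show ?thesis using e_B[of s] a_c[of s] by (simp add: t_def m_assoc)
    qed
  qed
  have H_L: "h \<in> locally_nilpotent_part G t" if h: "h \<in> H" "h \<otimes> h = \<one>" for h
  proof -
    obtain \<alpha> \<beta> where "\<alpha> \<in> A" "\<beta> \<in> B" "h = \<alpha> \<otimes> \<beta>" "\<alpha> \<otimes> \<alpha> = \<one>" "\<beta> \<otimes> \<beta> = \<one>"
      by (rule socle_of_direct_product[OF A.subgroup_axioms B.subgroup_axioms AB h[unfolded H_def]])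
    moreover from this have "\<alpha> \<in> locally_nilpotent_part G t" "\<beta> \<in> locally_nilpotent_part G t"
      using MS_L A_M B_S by blast+
    ultimately show ?thesis by simp
  qed
  have K_L: "y \<in> locally_nilpotent_part G t" if "y \<in> K" "y \<otimes> y = \<one>" "(t' ^^ n) y = \<one>" for y n
    using that
  proof (induction n arbitrary: y)
    case 0
    then show ?case using L.one_closed by simp
  next
    case (Suc n)
    have yc: "y \<in> carrier G" using Suc.prems by simp
    have t'y: "t' y \<in> K" using t'_c Suc.prems by blast
    have "t' y \<otimes> t' y = t' (y \<otimes> y)" using K_mult[OF t' Suc.prems(1,1)] by simp
    also have "\<dots> = \<one>" using K_one[OF t'] Suc.prems by simp
    finally have "t' y \<otimes> t' y = \<one>" .
    moreover have "(t' ^^ n) (t' y) = \<one>" using Suc.prems(3) by (simp add: funpow_swap1)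
    ultimately have t'yL: "t' y \<in> locally_nilpotent_part G t" by (rule Suc.IH[OF t'y])
    \<comment> \<open>The component of \<open>a y\<close> in \<open>H\<close>, an element of the socle of \<open>H\<close>, so of \<open>W\<close>.
      It is the difference between \<open>t y\<close> and \<open>t' y\<close>.\<close>
    define h where "h = a y \<otimes> inv \<pi> (a y)"
    have ayc: "a y \<in> carrier G" using a_c yc by blast
    have pc: "\<pi> (a y) \<in> carrier G" using \<pi>_K ayc by auto
    have a1: "a \<one> = \<one>" and p1: "\<pi> \<one> = \<one>" using hom_one[OF a is_group is_group] \<pi>_H H.one_closed by auto
    have "a y \<otimes> a y = \<one>" using mult[OF a yc yc] Suc.prems(2) a1 by simp
    moreover from this have "\<pi> (a y) \<otimes> \<pi> (a y) = \<one>" using mult[OF \<pi> ayc ayc] p1 by simp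
    moreover have "h \<otimes> h = (a y \<otimes> a y) \<otimes> inv (\<pi> (a y) \<otimes> \<pi> (a y))"
      using ayc pc unfolding h_def by (simp add: inv_mult m_ac)
    ultimately have "h \<otimes> h = \<one>" by simp
    moreover have hH: "h \<in> H" unfolding h_def using \<pi>_diff ayc by blast
    ultimately have hL: "h \<in> locally_nilpotent_part G t" using H_L by blast
    have e'y: "e' y \<in> carrier G" "t' y \<in> carrier G" using e'_c t'y Suc.prems by auto
    have "a y = h \<otimes> \<pi> (a y)" using ayc pc by (simp add: h_def m_assoc)
    also have "\<dots> = h \<otimes> (e' y \<otimes> t' y)" using et' Suc.prems by simp
    finally have "t y = h \<otimes> (e' y \<otimes> t' y) \<otimes> inv e' y"
      using e_K Suc.prems by (simp add: t_def)
    also have "\<dots> = h \<otimes> t' y"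
      using e'y hH by (simp add: m_assoc m_comm[of "e' y" "t' y"])
    finally have "t y \<in> locally_nilpotent_part G t" using hL t'yL by simp
    then show ?case using yc by (rule locally_nilpotent_back1)
  qed
  have "locally_nilpotent_part G t = carrier G"
  proof (rule locally_nilpotent_from_socle[OF t exp])
    fix x assume x: "x \<in> carrier G" "x \<otimes> x = \<one>"
    obtain h y where "h \<in> H" "y \<in> K" "x = h \<otimes> y" "h \<otimes> h = \<one>" "y \<otimes> y = \<one>"
      by (rule socle_of_direct_product[OF H.subgroup_axioms K HK(1), unfolded HK(2), OF x])
    moreover from this have "y \<in> locally_nilpotent_part G t" using K_L t'_nil by blast
    ultimately show "x \<in> locally_nilpotent_part G t" using H_L by simp
  qed
  then show ?thesis
    unfolding nil_clean_endo_def locally_nilpotent_part_def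
    using e t ae e_idem by blast
qed

end

theorem endo_of_finite_2_group_nil_clean:
  assumes "comm_group G" "finite (carrier G)"
    and "\<And>x. x \<in> carrier G \<Longrightarrow> x [^]\<^bsub>G\<^esub> ((2::nat) ^ N) = \<one>\<^bsub>G\<^esub>" and "a \<in> hom G G"
  shows "nil_clean_endo G a"
  using assms
proof (induction "card (carrier G)" arbitrary: G a rule: less_induct)
  case less
  interpret comm_group G by (rule less.prems)
  show ?case
  proof (cases "carrier G = {\<one>\<^bsub>G\<^esub>}")
    case True
    have "a \<one>\<^bsub>G\<^esub> = \<one>\<^bsub>G\<^esub>" using hom_one[OF less.prems(4) is_group is_group] .
    moreover have "\<exists>n. (a ^^ n) \<one>\<^bsub>G\<^esub> = \<one>\<^bsub>G\<^esub>" by (rule exI[of _ 0]) simp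
    ultimately show ?thesis
      unfolding nil_clean_endo_def using True less.prems(4)
      by (intro bexI[of _ a] bexI[of _ "\<lambda>_. \<one>\<^bsub>G\<^esub>"]) (auto simp: hom_def)
  next
    case False
    show ?thesis
    proof (rule nil_clean_endo_step[OF less.prems(2) False less.prems(3,4)])
      fix K b assume K: "subgroup K G" "card K < card (carrier G)"
        and b: "b \<in> hom (G\<lparr>carrier := K\<rparr>) (G\<lparr>carrier := K\<rparr>)"
      show "nil_clean_endo (G\<lparr>carrier := K\<rparr>) b"
      proof (rule less.hyps)
        show "comm_group (G\<lparr>carrier := K\<rparr>)"
          using group.group_comm_groupI[OF subgroup_imp_group[OF K(1)]] m_comm
            subgroup.mem_carrier[OF K(1)] by simp
        show "finite (carrier (G\<lparr>carrier := K\<rparr>))"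
          using finite_subset[OF subgroup.subset[OF K(1)] less.prems(2)] by simp
        show "x [^]\<^bsub>G\<lparr>carrier := K\<rparr>\<^esub> ((2::nat) ^ N) = \<one>\<^bsub>G\<lparr>carrier := K\<rparr>\<^esub>"
          if "x \<in> carrier (G\<lparr>carrier := K\<rparr>)" for x
          using that less.prems(3)[of x] subgroup.mem_carrier[OF K(1), of x]
            nat_pow_consistent[of x "2 ^ N" K] by simp
      qed (use K b in auto)
    qed
  qed
qed

section \<open>Exponent of a nil-clean group\<close>

text \<open>
  From \<open>2 = e + t\<close> and \<open>e\<^sup>2 = e\<close> follows \<open>2 e = e + t e\<close>, hence \<open>t e = e\<close>, and likewise \<open>e t = e\<close>.
  Therefore \<open>2 = t + e = t (1 + e) = (1 + e) t\<close>.
\<close>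

lemma (in ring) nil_clean_two_nilpotent:
  assumes "nil_clean_elem R (\<one> \<oplus> \<one>)"
  shows "\<exists>k::nat. (\<one> \<oplus> \<one>) [^] k = \<zero>"
proof -
  obtain e t k where e: "e \<in> carrier R" "e \<otimes> e = e" and t: "t \<in> carrier R" "t [^] (k::nat) = \<zero>"
    and two: "\<one> \<oplus> \<one> = e \<oplus> t"
    using assms unfolding nil_clean_elem_def idempotent_elem_def nilpotent_elem_def by blast
  have "e \<oplus> e = (\<one> \<oplus> \<one>) \<otimes> e" "e \<oplus> e = e \<otimes> (\<one> \<oplus> \<one>)"
    using e by (simp_all add: l_distr r_distr)
  then have "e \<oplus> e = e \<oplus> t \<otimes> e" "e \<oplus> e = e \<oplus> e \<otimes> t"
    unfolding two using e t by (simp_all add: l_distr r_distr)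
  then have "t \<otimes> e = e" "e \<otimes> t = e" using e t by simp_all
  then have tu: "t \<otimes> (\<one> \<oplus> e) = \<one> \<oplus> \<one>" and ut: "(\<one> \<oplus> e) \<otimes> t = \<one> \<oplus> \<one>"
    unfolding two using e t by (simp_all add: l_distr r_distr a_comm)
  have "(\<one> \<oplus> \<one>) [^] k = t [^] k \<otimes> (\<one> \<oplus> e) [^] k"
    unfolding tu[symmetric] using tu ut e t by (intro pow_mult_distrib) auto
  also have "\<dots> = \<zero>" using t e by simp
  finally show ?thesis by blast
qed

lemma (in comm_group) End_ring_two_pow:
  assumes "x \<in> carrier G"
  shows "((\<one>\<^bsub>End_ring G\<^esub> \<oplus>\<^bsub>End_ring G\<^esub> \<one>\<^bsub>End_ring G\<^esub>) [^]\<^bsub>End_ring G\<^esub> k) x = x [^] ((2::nat) ^ k)"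
  using assms
proof (induction k arbitrary: x)
  case 0
  then show ?case by (simp add: End_ring_def)
next
  case (Suc k)
  have "((\<one>\<^bsub>End_ring G\<^esub> \<oplus>\<^bsub>End_ring G\<^esub> \<one>\<^bsub>End_ring G\<^esub>) [^]\<^bsub>End_ring G\<^esub> Suc k) x =
      ((\<one>\<^bsub>End_ring G\<^esub> \<oplus>\<^bsub>End_ring G\<^esub> \<one>\<^bsub>End_ring G\<^esub>) [^]\<^bsub>End_ring G\<^esub> k) (x \<otimes> x)"
    using Suc.prems by (simp add: End_ring_def compose_def)
  also have "\<dots> = x [^] ((2::nat) ^ Suc k)"
    using Suc.IH[of "x \<otimes> x"] Suc.prems square_pow[OF Suc.prems] by simp
  finally show ?case .
qed

lemma nil_clean_group_exponent:
  assumes "comm_group G" "nil_clean_group G"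
  obtains k where "\<And>x. x \<in> carrier G \<Longrightarrow> x [^]\<^bsub>G\<^esub> ((2::nat) ^ k) = \<one>\<^bsub>G\<^esub>"
proof -
  interpret comm_group G by fact
  interpret R: ring "End_ring G" by (rule ring_End_ring) fact
  let ?two = "\<one>\<^bsub>End_ring G\<^esub> \<oplus>\<^bsub>End_ring G\<^esub> \<one>\<^bsub>End_ring G\<^esub>"
  have "nil_clean_elem (End_ring G) ?two"
    using assms(2) by (simp add: nil_clean_group_def nil_clean_ring_def)
  from R.nil_clean_two_nilpotent[OF this]
  obtain k :: nat where k: "?two [^]\<^bsub>End_ring G\<^esub> k = \<zero>\<^bsub>End_ring G\<^esub>" by blast
  show ?thesis
  proof (rule that[of k])
    fix x assume x: "x \<in> carrier G"
    have "x [^]\<^bsub>G\<^esub> ((2::nat) ^ k) = (\<zero>\<^bsub>End_ring G\<^esub>) x"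
      unfolding k[symmetric] using End_ring_two_pow[OF x] by simp
    then show "x [^]\<^bsub>G\<^esub> ((2::nat) ^ k) = \<one>\<^bsub>G\<^esub>" using x by (simp add: End_ring_def)
  qed
qed

lemma (in group) two_power_ord:
  assumes "x \<in> carrier G" "x [^] ((2::nat) ^ k) = \<one>"
  shows "\<exists>j. ord x = 2 ^ j"
  using assms pow_eq_id divides_primepow_nat[of 2 "ord x" k] two_is_prime_nat by blast

section \<open>Finite rank and bounded exponent\<close>

lemma (in comm_group) finite_generate_of_exponent:
  assumes "finite X" "X \<subseteq> carrier G" "n > 0" and exp: "\<And>x. x \<in> carrier G \<Longrightarrow> x [^] (n::nat) = \<one>"
  shows "\<exists>S. subgroup S G \<and> finite S \<and> X \<subseteq> S"
  using assms(1,2)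
proof (induction X rule: finite_induct)
  case empty
  then show ?case using triv_subgroup by blast
next
  case (insert x X)
  then obtain S where S: "subgroup S G" "finite S" "X \<subseteq> S" by auto
  interpret S: subgroup S G by (rule S)
  have x: "x \<in> carrier G" using insert.prems by simp
  have "ord x \<noteq> 0" using exp[OF x] \<open>n > 0\<close> ord_eq_0[OF x] by auto
  then have fin: "finite (generate G {x})" using generate_pow_card[OF x] card.infinite by metis
  have sub: "subgroup (generate G {x}) G" using x by (intro generate_is_subgroup) auto
  have "subgroup (generate G {x} <#> S) G" using sub S(1) by (rule mult_subgroups)
  moreover have "finite (generate G {x} <#> S)" using fin S(2) by (simp add: set_mult_def)
  moreover have "insert x X \<subseteq> generate G {x} <#> S"
    using subset_set_mult[OF sub S(1)] S(3) generate.incl[of x "{x}" G] by auto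
  ultimately show ?case by blast
qed

text \<open>
  In a relation among \<open>y\<close> and elements of \<open>X\<close>, the multiple of \<open>y\<close> lies in \<open>S\<close>. As \<open>y\<close> has order \<open>2\<close> and
  is not in \<open>S\<close>, this multiple vanishes, which leaves a relation among elements of \<open>X\<close>.
\<close>

lemma (in comm_group) rank_system_insert:
  assumes X: "rank_system G X" and S: "subgroup S G" "X \<subseteq> S"
    and y: "y \<in> carrier G" "y \<otimes> y = \<one>" "y \<notin> S"
  shows "rank_system G (insert y X)"
proof -
  interpret S: subgroup S G by fact
  have y1: "y \<noteq> \<one>" using y S.one_closed by blast
  have y2: "y [^] (2::nat) = \<one>" using y by (simp add: numeral_2_eq_2)
  have "ord y dvd 2" using y2 y(1) pow_eq_id by blast
  then have "ord y = 1 \<or> ord y = 2" using two_is_prime_nat by (simp add: prime_nat_iff)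
  moreover have "ord y \<noteq> 1" using y1 ord_eq_1[OF y(1)] by simp
  ultimately have "ord y = 2" by simp
  then have "primepow (ord y)" using primepow_prime two_is_prime_nat by metis
  moreover have "independent_set G (insert y X)"
    unfolding independent_set_def
  proof (intro conjI allI impI)
    have ind: "independent_set G X" using X by (simp add: rank_system_def)
    then show "insert y X \<subseteq> carrier G" "\<one> \<notin> insert y X"
      using y y1 by (auto simp: independent_set_def)
    fix F and n :: "'a \<Rightarrow> int"
    assume F: "finite F \<and> F \<subseteq> insert y X \<and> (\<Otimes>x\<in>F. x [^] n x) = \<one>"
    have FX: "\<forall>x\<in>F'. x [^] n x = \<one>" if "finite F'" "F' \<subseteq> X" "(\<Otimes>x\<in>F'. x [^] n x) = \<one>" for F'
      using ind that unfolding independent_set_def by blast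
    have Xc: "X \<subseteq> carrier G" using S S.subset by blast
    show "\<forall>x\<in>F. x [^] n x = \<one>"
    proof (cases "y \<in> F")
      case False
      then show ?thesis using F FX by blast
    next
      case True
      define F' where "F' = F - {y}"
      have F': "finite F'" "F' \<subseteq> X" "y \<notin> F'" "F = insert y F'" using F True by (auto simp: F'_def)
      have "(\<Otimes>x\<in>F'. x [^] n x) \<in> S"
        using F'(1,2)
      proof (induction F' rule: finite_induct)
        case (insert z F')
        have "z [^] n z \<in> S" using insert.prems S by (intro subgroup_int_pow_closed) auto
        then show ?case using insert Xc by (subst finprod_insert) auto
      qed (use S.one_closed in simp)
      then have P: "(\<Otimes>x\<in>F'. x [^] n x) \<in> S" "(\<Otimes>x\<in>F'. x [^] n x) \<in> carrier G" by auto
      have eq: "y [^] n y \<otimes> (\<Otimes>x\<in>F'. x [^] n x) = \<one>"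
        using F F' Xc y(1) by (subst (asm) F'(4), subst (asm) finprod_insert) auto
      then have "y [^] n y = inv (\<Otimes>x\<in>F'. x [^] n x)"
        using inv_equality[OF eq] P y(1) by simp
      then have yS: "y [^] n y \<in> S" using P by simp
      have y2': "y [^] (2::int) = \<one>" using y2 int_pow_int[of G y 2] by simp
      have "y [^] n y = y [^] (2 * (n y div 2)) \<otimes> y [^] (n y mod 2)"
        using y(1) by (simp flip: int_pow_mult)
      also have "y [^] (2 * (n y div 2)) = \<one>"
        using int_pow_pow[OF y(1), of 2 "n y div 2"] y2' by simp
      finally have "y [^] n y = y [^] (n y mod 2)" using y(1) by simp
      moreover have "n y mod 2 = 0 \<or> n y mod 2 = 1" by presburger
      ultimately have "y [^] n y = \<one>" using yS y(1,3) by auto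
      then show ?thesis using eq P FX[OF F'(1,2)] F'(4) by auto
    qed
  qed
  ultimately show ?thesis using X by (auto simp: rank_system_def)
qed

text \<open>
  Doubling maps the elements killed by \<open>2\<^sup>j\<^sup>+\<^sup>1\<close> to those killed by \<open>2\<^sup>j\<close>, and its fibres are
  cosets of the socle or empty.
\<close>

lemma (in comm_group) finite_of_finite_socle:
  assumes soc: "finite {x \<in> carrier G. x \<otimes> x = \<one>}"
    and exp: "\<And>x. x \<in> carrier G \<Longrightarrow> x [^] ((2::nat) ^ k) = \<one>"
  shows "finite (carrier G)"
proof -
  have "finite {x \<in> carrier G. x [^] ((2::nat) ^ j) = \<one>}" for j
  proof (induction j)
    case 0
    have "{x \<in> carrier G. x [^] ((2::nat) ^ 0) = \<one>} \<subseteq> {\<one>}" by auto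
    then show ?case using finite_subset by blast
  next
    case (Suc j)
    let ?D = "{x \<in> carrier G. x [^] ((2::nat) ^ Suc j) = \<one>}"
    show ?case
    proof (rule finite_finite_vimage_IntI[where h = "\<lambda>x. x \<otimes> x", of "{x \<in> carrier G. x [^] ((2::nat) ^ j) = \<one>}" ?D, THEN finite_subset[rotated]])
      show "?D \<subseteq> (\<lambda>x. x \<otimes> x) -` {x \<in> carrier G. x [^] ((2::nat) ^ j) = \<one>} \<inter> ?D"
        using square_pow by auto
      show "finite ((\<lambda>x. x \<otimes> x) -` {z} \<inter> ?D)" for z
      proof (cases "\<exists>y \<in> carrier G. y \<otimes> y = z")
        case True
        then obtain y where y: "y \<in> carrier G" "y \<otimes> y = z" by blast
        have "(\<lambda>x. x \<otimes> x) -` {z} \<inter> ?D \<subseteq> (\<lambda>x. x \<otimes> y) ` {x \<in> carrier G. x \<otimes> x = \<one>}"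
        proof safe
          fix x assume x: "x \<in> carrier G" "z = x \<otimes> x"
          have "(x \<otimes> inv y) \<otimes> (x \<otimes> inv y) = (x \<otimes> x) \<otimes> inv (y \<otimes> y)"
            using x(1) y(1) by (simp add: inv_mult m_ac)
          also have "\<dots> = \<one>" using x y by simp
          finally show "x \<in> (\<lambda>x. x \<otimes> y) ` {x \<in> carrier G. x \<otimes> x = \<one>}"
            using x(1) y(1) by (intro image_eqI[of _ _ "x \<otimes> inv y"]) (simp_all add: m_assoc)
        qed
        then show ?thesis using soc finite_subset by blast
      next
        case False
        then have "(\<lambda>x. x \<otimes> x) -` {z} \<inter> ?D = {}" by auto
        then show ?thesis by (simp only: finite.emptyI)
      qed
    qed (rule Suc.IH)
  qed
  from this[of k] show ?thesis using exp by (simp cong: conj_cong)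
qed

lemma (in comm_group) finite_of_finite_rank:
  assumes rk: "finite_rank G" and exp: "\<And>x. x \<in> carrier G \<Longrightarrow> x [^] ((2::nat) ^ k) = \<one>"
  shows "finite (carrier G)"
proof -
  obtain X where X: "maximal_rank_system G X" "finite X" using rk by (auto simp: finite_rank_def)
  have rX: "rank_system G X" using X by (simp add: maximal_rank_system_def)
  then have "X \<subseteq> carrier G" by (simp add: rank_system_def independent_set_def)
  from finite_generate_of_exponent[OF X(2) this _ exp]
  obtain S where S: "subgroup S G" "finite S" "X \<subseteq> S" by auto
  have "{x \<in> carrier G. x \<otimes> x = \<one>} \<subseteq> S"
  proof safe
    fix y assume y: "y \<in> carrier G" "y \<otimes> y = \<one>"
    show "y \<in> S"
    proof (rule ccontr)
      assume "y \<notin> S"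
      with rank_system_insert[OF rX S(1,3) y] have "rank_system G (insert y X)" by blast
      then have "insert y X = X" using X(1) unfolding maximal_rank_system_def by blast
      then show False using S(3) \<open>y \<notin> S\<close> by blast
    qed
  qed
  then have "finite {x \<in> carrier G. x \<otimes> x = \<one>}" using S(2) finite_subset by blast
  then show ?thesis using exp by (rule finite_of_finite_socle)
qed

section \<open>Nil-clean groups of finite rank\<close>

lemma (in comm_group) End_ring_pow:
  assumes "t \<in> hom G G" "x \<in> carrier G"
  shows "(restrict t (carrier G) [^]\<^bsub>End_ring G\<^esub> (n::nat)) x = (t ^^ n) x"
  using assms(2)
proof (induction n arbitrary: x)
  case 0
  then show ?case by (simp add: End_ring_def)
next
  case (Suc n)
  have "(restrict t (carrier G) [^]\<^bsub>End_ring G\<^esub> Suc n) x =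
      (restrict t (carrier G) [^]\<^bsub>End_ring G\<^esub> n) (t x)"
    using Suc.prems by (simp add: End_ring_def compose_def)
  also have "\<dots> = (t ^^ n) (t x)" by (rule Suc.IH[OF hom_in_carrier[OF assms(1) Suc.prems]])
  also have "\<dots> = (t ^^ Suc n) x" by (simp add: funpow_swap1)
  finally show ?case .
qed

lemma nil_clean_group_of_endo:
  assumes "comm_group G" and fin: "finite (carrier G)"
    and nc: "\<And>a. a \<in> hom G G \<Longrightarrow> nil_clean_endo G a"
  shows "nil_clean_group G"
  unfolding nil_clean_group_def nil_clean_ring_def
proof (intro conjI ballI)
  interpret comm_group G by fact
  show "ring (End_ring G)" by (rule ring_End_ring) fact
  interpret R: ring "End_ring G" by fact
  fix a assume a: "a \<in> carrier (End_ring G)"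
  then have "a \<in> hom G G" and a_ext: "a \<in> extensional (carrier G)" by (simp_all add: End_ring_def)
  from nc[OF this(1)] obtain e t where e: "e \<in> hom G G" and t: "t \<in> hom G G"
    and ae: "\<And>x. x \<in> carrier G \<Longrightarrow> a x = e x \<otimes>\<^bsub>G\<^esub> t x"
    and idem: "\<And>x. x \<in> carrier G \<Longrightarrow> e (e x) = e x"
    and nil: "\<And>x. x \<in> carrier G \<Longrightarrow> \<exists>n. (t ^^ n) x = \<one>\<^bsub>G\<^esub>"
    unfolding nil_clean_endo_def by blast
  define e' where "e' = restrict e (carrier G)"
  define t' where "t' = restrict t (carrier G)"
  have mem: "restrict f (carrier G) \<in> carrier (End_ring G)" if "f \<in> hom G G" for f
    using that by (auto simp: End_ring_def hom_def)
  have ext: "f = g" if "f \<in> carrier (End_ring G)" "g \<in> carrier (End_ring G)"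
    "\<And>x. x \<in> carrier G \<Longrightarrow> f x = g x" for f g
    using that by (auto simp: End_ring_def intro: extensionalityI)
  have e': "e' \<in> carrier (End_ring G)" and t': "t' \<in> carrier (End_ring G)"
    using mem e t by (auto simp: e'_def t'_def)
  have "idempotent_elem (End_ring G) e'"
    unfolding idempotent_elem_def
  proof
    show "e' \<otimes>\<^bsub>End_ring G\<^esub> e' = e'"
    proof (rule ext)
      show "(e' \<otimes>\<^bsub>End_ring G\<^esub> e') x = e' x" if "x \<in> carrier G" for x
        using that idem hom_in_carrier[OF e] by (simp add: End_ring_def compose_def e'_def)
    qed (use e' in auto)
  qed (rule e')
  moreover have "nilpotent_elem (End_ring G) t'"
    unfolding nilpotent_elem_def
  proof
    obtain n where n: "\<And>x. x \<in> carrier G \<Longrightarrow> (t ^^ n x) x = \<one>\<^bsub>G\<^esub>" using nil by metis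
    \<comment> \<open>A common bound for the pointwise nilpotency indices.\<close>
    define m where "m = (\<Sum>x\<in>carrier G. n x)"
    have "(t ^^ m) x = \<one>\<^bsub>G\<^esub>" if x: "x \<in> carrier G" for x
    proof -
      have "n x \<le> m" unfolding m_def using fin x by (intro member_le_sum) auto
      then obtain d where "m = d + n x" by (metis le_add_diff_inverse2)
      then show ?thesis using n[OF x] hom_funpow_one[OF t] by (simp add: funpow_add)
    qed
    moreover have "\<zero>\<^bsub>End_ring G\<^esub> x = \<one>\<^bsub>G\<^esub>" if "x \<in> carrier G" for x
      using that by (simp add: End_ring_def)
    ultimately have "(t' [^]\<^bsub>End_ring G\<^esub> m) x = \<zero>\<^bsub>End_ring G\<^esub> x" if "x \<in> carrier G" for x
      using End_ring_pow[OF t that, of m] that unfolding t'_def by simp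
    then have "t' [^]\<^bsub>End_ring G\<^esub> m = \<zero>\<^bsub>End_ring G\<^esub>"
      by (rule ext[OF R.nat_pow_closed[OF t'] R.zero_closed])
    then show "\<exists>k::nat. t' [^]\<^bsub>End_ring G\<^esub> k = \<zero>\<^bsub>End_ring G\<^esub>" by blast
  qed (rule t')
  moreover have "a = e' \<oplus>\<^bsub>End_ring G\<^esub> t'"
  proof (rule ext)
    show "a x = (e' \<oplus>\<^bsub>End_ring G\<^esub> t') x" if "x \<in> carrier G" for x
      using that ae by (simp add: End_ring_def e'_def t'_def)
  qed (use a e' t' in auto)
  ultimately show "nil_clean_elem (End_ring G) a" unfolding nil_clean_elem_def by blast
qed

theorem proposition9:
  fixes G :: "('a, 'b) monoid_scheme"
  assumes "comm_group G" and "finite_rank G"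
  shows "nil_clean_group G \<longleftrightarrow> finite (carrier G) \<and> p_group 2 G"
proof
  interpret comm_group G by (rule assms(1))
  assume "nil_clean_group G"
  with assms(1) obtain k where exp: "\<And>x. x \<in> carrier G \<Longrightarrow> x [^]\<^bsub>G\<^esub> ((2::nat) ^ k) = \<one>\<^bsub>G\<^esub>"
    by (rule nil_clean_group_exponent) blast
  show "finite (carrier G) \<and> p_group 2 G"
    using finite_of_finite_rank[OF assms(2) exp] two_power_ord[OF _ exp] is_group
    by (auto simp: p_group_def)
next
  interpret comm_group G by (rule assms(1))
  assume G: "finite (carrier G) \<and> p_group 2 G"
  have exp: "x [^]\<^bsub>G\<^esub> ((2::nat) ^ order G) = \<one>\<^bsub>G\<^esub>" if x: "x \<in> carrier G" for x
  proof -
    obtain k where k: "ord x = 2 ^ k" using G x by (auto simp: p_group_def)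
    \<comment> \<open>The order of \<open>G\<close> serves as a crude exponent: \<open>k < 2\<^sup>k \<le> |G|\<close>.\<close>
    have "ord x dvd order G" "order G > 0"
      using x G ord_dvd_group_order order_gt_0_iff_finite by auto
    then have "2 ^ k \<le> order G" using k dvd_imp_le by metis
    then have "k \<le> order G" using less_exp[of k] by linarith
    then have "ord x dvd 2 ^ order G" unfolding k by (rule le_imp_power_dvd)
    then show ?thesis using pow_eq_id[OF x] by blast
  qed
  show "nil_clean_group G"
    using assms(1) G exp by (intro nil_clean_group_of_endo endo_of_finite_2_group_nil_clean) auto
qed

end
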